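(* Let $0<\alpha<1/2$ and $p\in(0,1)$. There exist constants $K_0>0$ and $M$ such that $f_\alpha(n)\le e^{-K_0 n^{1/2-\alpha}}$ for all $n\ge M$.
   Context: A graph $G$ on $n$ vertices is even-degenerate if there is an ordering $v_1,\dots,v_n$ of its vertices such that for every $1\le i\le n-2$, $v_i$ has an even number of neighbours in $\{v_{i+1},\dots,v_n\}$. A random graph $G=(V,E)$ with $|V|=n$ is an $\alpha$-partially revealed $p$-graph if there is $A\subseteq V$ with $|A|\le n^{1-2\alpha}$ such that $G$ is distributed as $G(n,p)$ on $V$ conditioned on a fixed feasible value of $G[A]$, the parities of $\deg_G(a)$ for all $a\in A$, and the parity of $|E|$. $f_\alpha(n)$ is the maximum, over all $\alpha$-partially revealed $p$-graphs on $n$ vertices, of the probability of not being even-degenerate. (The paper writes the conclusion as $f_\alpha(n)\le e^{-\Omega(n^{1/2-\alpha})}$.) *)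

theory Defs
  imports "HOL-Probability.Probability"
begin

text \<open>
  A simple graph on the vertex set \<open>V\<close> is represented by its edge set, a subset of
  \<open>vertex_pairs V\<close>.
\<close>

definition vertex_pairs :: "'a set \<Rightarrow> 'a set set" where
  "vertex_pairs V = {e. e \<subseteq> V \<and> card e = 2}"

definition degree :: "'a set set \<Rightarrow> 'a \<Rightarrow> nat" where
  "degree E v = card {e \<in> E. v \<in> e}"

definition induced_edges :: "'a set set \<Rightarrow> 'a set \<Rightarrow> 'a set set" where
  "induced_edges E A = {e \<in> E. e \<subseteq> A}"

definition even_degenerate :: "'a set \<Rightarrow> 'a set set \<Rightarrow> bool" where
  "even_degenerate V E \<longleftrightarrow>
     (\<exists>v :: nat \<Rightarrow> 'a. bij_betw v {1..card V} V \<and>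
        (\<forall>i. 1 \<le> i \<and> i \<le> card V - 2 \<longrightarrow>
           even (card {w \<in> v ` {i+1..card V}. {v i, w} \<in> E})))"

definition gnp :: "'a set \<Rightarrow> real \<Rightarrow> 'a set set pmf" where
  "gnp V p = map_pmf (\<lambda>f. {e. f e}) (Pi_pmf (vertex_pairs V) False (\<lambda>_. bernoulli_pmf p))"

text \<open>
  The event that \<open>G[A]\<close> has edge set \<open>H\<close>, that the degree of each \<open>a \<in> A\<close> in the whole
  graph has parity \<open>d a\<close>, and that the number of edges has parity \<open>b\<close> (\<open>True\<close> means even).
\<close>

definition revealed_event ::
    "'a set \<Rightarrow> 'a set set \<Rightarrow> ('a \<Rightarrow> bool) \<Rightarrow> bool \<Rightarrow> 'a set set set" where
  "revealed_event A H d b =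
     {E. induced_edges E A = H \<and> (\<forall>a\<in>A. even (degree E a) = d a) \<and> even (card E) = b}"

text \<open>
  In the next definition \<open>G\<close> is the law of the random graph. The revealed value is feasible
  if it is attained with positive probability, i.e. if the event meets the support; this is
  also what makes \<^const>\<open>cond_pmf\<close> meaningful.
\<close>

definition partially_revealed ::
    "real \<Rightarrow> real \<Rightarrow> 'a set \<Rightarrow> 'a set set pmf \<Rightarrow> bool" where
  "partially_revealed \<alpha> p V G \<longleftrightarrow>
     finite V \<and>
     (\<exists>A H d b. A \<subseteq> V \<and> real (card A) \<le> real (card V) powr (1 - 2 * \<alpha>) \<and>
        set_pmf (gnp V p) \<inter> revealed_event A H d b \<noteq> {} \<and>
        G = cond_pmf (gnp V p) (revealed_event A H d b))"

definition failure_probs :: "real \<Rightarrow> real \<Rightarrow> nat \<Rightarrow> real set" where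
  "failure_probs \<alpha> p n =
     {measure_pmf.prob G {E. \<not> even_degenerate V E} | (V :: nat set) G.
        card V = n \<and> partially_revealed \<alpha> p V G}"

definition f_max :: "real \<Rightarrow> real \<Rightarrow> nat \<Rightarrow> real" where
  "f_max \<alpha> p n = Max (failure_probs \<alpha> p n)"

text \<open>
  \<^const>\<open>Max\<close> is meaningful only for finite nonempty sets; although \<open>V\<close> ranges over infinitely
  many vertex sets, \<^const>\<open>failure_probs\<close> is such a set: \<open>failure_probs_nonempty\<close> and
  \<open>finite_failure_probs\<close> below.
\<close>

lemma finite_vertex_pairs: "finite V \<Longrightarrow> finite (vertex_pairs V)"
  unfolding vertex_pairs_def by (rule finite_subset[of _ "Pow V"]) auto

lemma card_vertex_pairs: "finite V \<Longrightarrow> card (vertex_pairs V) = card V choose 2"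
  unfolding vertex_pairs_def by (rule n_subsets)

lemma set_gnp_subset: "finite V \<Longrightarrow> set_pmf (gnp V p) \<subseteq> Pow (vertex_pairs V)"
  using set_Pi_pmf_subset[OF finite_vertex_pairs, of V False "\<lambda>_. bernoulli_pmf p"]
  unfolding gnp_def by auto

lemma pmf_gnp:
  assumes "finite V" "0 < p" "p < 1" "E \<subseteq> vertex_pairs V"
  shows "pmf (gnp V p) E = p ^ card E * (1 - p) ^ ((card V choose 2) - card E)"
proof -
  let ?P = "vertex_pairs V"
  note fin = finite_vertex_pairs[OF assms(1)]
  have "inj (\<lambda>f :: 'a set \<Rightarrow> bool. {e. f e})" by (auto simp: inj_def)
  from pmf_map_inj'[OF this, of "Pi_pmf ?P False (\<lambda>_. bernoulli_pmf p)" "\<lambda>e. e \<in> E"]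
  have "pmf (gnp V p) E = pmf (Pi_pmf ?P False (\<lambda>_. bernoulli_pmf p)) (\<lambda>e. e \<in> E)"
    by (simp add: gnp_def)
  also have "\<dots> = (\<Prod>e\<in>?P. pmf (bernoulli_pmf p) (e \<in> E))"
    by (rule pmf_Pi'[OF fin]) (use assms in auto)
  also have "\<dots> = (\<Prod>e\<in>?P. if e \<in> E then p else 1 - p)"
    by (rule prod.cong) (use assms in auto)
  also have "\<dots> = p ^ card (?P \<inter> E) * (1 - p) ^ card (?P - E)"
    using fin by (simp add: prod.If_cases Diff_eq)
  also have "?P \<inter> E = E" using assms by auto
  also have "card (?P - E) = (card V choose 2) - card E"
    using assms fin by (simp add: card_Diff_subset finite_subset card_vertex_pairs)
  finally show ?thesis .
qed

lemma empty_in_set_gnp: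
  assumes "finite V" "0 < p" "p < 1"
  shows "{} \<in> set_pmf (gnp V p)"
  using pmf_gnp[OF assms, of "{}"] assms by (simp add: set_pmf_iff)

lemma prob_gnp:
  fixes S :: "'a set set set"
  assumes "finite V" "0 < p" "p < 1"
  defines "N \<equiv> card V choose 2"
  shows "measure_pmf.prob (gnp V p) S =
    (\<Sum>k\<le>N. real (card {E \<in> S \<inter> Pow (vertex_pairs V). card E = k}) * (p ^ k * (1 - p) ^ (N - k)))"
proof -
  let ?S = "S \<inter> Pow (vertex_pairs V)"
  have fin: "finite ?S" using finite_vertex_pairs[OF assms(1)] by auto
  have le: "card E \<le> N" if "E \<in> ?S" for E
    using that card_mono[OF finite_vertex_pairs[OF assms(1)], of E]
    by (auto simp: card_vertex_pairs[OF assms(1)] N_def)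
  have "measure_pmf.prob (gnp V p) S = measure_pmf.prob (gnp V p) ?S"
    using set_gnp_subset[OF assms(1), of p]
    by (intro measure_eq_AE) (auto simp: AE_measure_pmf_iff)
  also have "\<dots> = (\<Sum>E\<in>?S. p ^ card E * (1 - p) ^ (N - card E))"
    unfolding measure_measure_pmf_finite[OF fin]
    by (rule sum.cong) (auto simp: pmf_gnp[OF assms(1-3)] N_def)
  also have "\<dots> = (\<Sum>k\<le>N. \<Sum>E\<in>{E \<in> ?S. card E = k}. p ^ card E * (1 - p) ^ (N - card E))"
    by (rule sum.group[symmetric]) (use fin le in auto)
  also have "\<dots> = (\<Sum>k\<le>N. real (card {E \<in> ?S. card E = k}) * (p ^ k * (1 - p) ^ (N - k)))"
    by (rule sum.cong) auto
  finally show ?thesis .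
qed

lemma prob_cond_pmf:
  assumes "set_pmf P \<inter> S \<noteq> {}"
  shows "measure_pmf.prob (cond_pmf P S) B = measure_pmf.prob P (S \<inter> B) / measure_pmf.prob P S"
  using assms by (simp add: cond_pmf.rep_eq measure_uniform_measure emeasure_measure_pmf_not_zero)

lemma finite_failure_probs:
  assumes "0 < p" "p < 1"
  shows "finite (failure_probs \<alpha> p n)"
proof -
  define N where "N = n choose 2"
  define X where "X = (\<lambda>c. \<Sum>k\<le>N. real (c k) * (p ^ k * (1 - p) ^ (N - k))) `
    (PiE {..N} (\<lambda>_. {..2 ^ N :: nat}))"
  have X: "measure_pmf.prob (gnp V p) S \<in> X" if V: "finite V" "card V = n"
    for V :: "nat set" and S
  proof -
    let ?c = "\<lambda>k. card {E \<in> S \<inter> Pow (vertex_pairs V). card E = k}"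
    have "?c k \<le> 2 ^ N" for k
      using card_mono[of "Pow (vertex_pairs V)" "{E \<in> S \<inter> Pow (vertex_pairs V). card E = k}"]
        finite_vertex_pairs[OF V(1)] V
      by (auto simp: card_Pow card_vertex_pairs N_def)
    then have "restrict ?c {..N} \<in> PiE {..N} (\<lambda>_. {..2 ^ N})" by auto
    moreover have "measure_pmf.prob (gnp V p) S =
        (\<Sum>k\<le>N. real (restrict ?c {..N} k) * (p ^ k * (1 - p) ^ (N - k)))"
      using prob_gnp[OF V(1) assms, of S] V by (simp add: N_def)
    ultimately show ?thesis unfolding X_def by blast
  qed
  have "finite X" unfolding X_def by (intro finite_imageI finite_PiE) auto
  moreover have "failure_probs \<alpha> p n \<subseteq> (\<lambda>(x, y). x / y) ` (X \<times> X)"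
  proof
    fix r assume "r \<in> failure_probs \<alpha> p n"
    then obtain V :: "nat set" and S where V: "finite V" "card V = n"
      and S: "set_pmf (gnp V p) \<inter> S \<noteq> {}"
      and r: "r = measure_pmf.prob (cond_pmf (gnp V p) S) {E. \<not> even_degenerate V E}"
      unfolding failure_probs_def partially_revealed_def by blast
    show "r \<in> (\<lambda>(x, y). x / y) ` (X \<times> X)"
      unfolding r prob_cond_pmf[OF S]
      by (rule image_eqI[where x = "(_, _)"]) (use X[OF V] in auto)
  qed
  ultimately show ?thesis by (meson finite_SigmaI finite_imageI finite_subset)
qed

lemma failure_probs_nonempty:
  assumes "0 < p" "p < 1"
  shows "failure_probs \<alpha> p n \<noteq> {}"
proof -
  define S :: "nat set set set" where "S = revealed_event {} {} (\<lambda>_. True) True"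
  have "{} \<in> set_pmf (gnp {..<n} p) \<inter> S"
    using empty_in_set_gnp[of "{..<n}" p] assms
    by (auto simp: S_def revealed_event_def induced_edges_def)
  then have "partially_revealed \<alpha> p {..<n} (cond_pmf (gnp {..<n} p) S)"
    unfolding partially_revealed_def S_def
    by (intro conjI finite_lessThan exI[of _ "{}"] exI[of _ "\<lambda>_. True"] exI[of _ True]) auto
  then show ?thesis unfolding failure_probs_def by (force intro: card_lessThan)
qed

end

theory Submission
  imports Defs "HOL-Real_Asymp.Real_Asymp"
begin

text \<open>
  The idea is to fix in advance how the elimination ends and to make it recoverable. From a
  reservoir \<open>P\<close> of about \<open>n powr (1/2 - \<alpha>)\<close> fresh vertices one greedily selects a chain \<open>W\<close>, each
  member having an even number of neighbours among a root \<open>z\<close> and the earlier members (only the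
  edge from \<open>z\<close> to the first member is prescribed by the parity of the number of edges). Every initial
  segment of the chain can be eliminated down to two vertices, so it suffices to reach one of them.

  The rejected vertices of \<open>P\<close> are eliminated first, each with the help of an even neighbour taken
  from its own batch of fresh vertices. Then the chain is consumed from the top: its last member
  \<open>w\<close>, if even, is removed, which flips a random set of parities in the set \<open>X\<close> of all other
  vertices, and \<open>X\<close> is swept once, removing every vertex that is even when its turn comes; if \<open>w\<close> is
  odd, it joins \<open>X\<close>. A step multiplies the expected size of a large \<open>X\<close> by a constant less than 1, and
  empties a small \<open>X\<close> with probability bounded below, as the parity of the number of edges is
  right. Hence \<open>card X\<close> plus a constant decays geometrically as long as \<open>X\<close> is not empty, and
  failure has probability exponentially small in \<open>card W\<close>.

  The only property of the random graph that is used is that flipping one edge changes the weight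
  of a graph by at most a constant factor \<open>\<rho>\<close>. Conditional independence is replaced by families of
  graphs that are closed under toggling suitable sets of edges.
\<close>

section \<open>Toggling edges and eliminating vertices\<close>

definition toggle :: "'e set \<Rightarrow> 'e set \<Rightarrow> 'e set" where
  "toggle E T = {e. (e \<in> E) \<noteq> (e \<in> T)}"

lemma in_toggle [simp]: "e \<in> toggle E T \<longleftrightarrow> (e \<in> E) \<noteq> (e \<in> T)"
  by (simp add: toggle_def)

lemma toggle_toggle [simp]: "toggle (toggle E T) T = E"
  by (auto simp: toggle_def)

lemma toggle_empty [simp]: "toggle E {} = E"
  by (auto simp: toggle_def)

lemma toggle_Un: "S \<inter> T = {} \<Longrightarrow> toggle (toggle E S) T = toggle E (S \<union> T)"
  by (auto simp: toggle_def)

lemma toggle_subset: "E \<subseteq> A \<Longrightarrow> T \<subseteq> A \<Longrightarrow> toggle E T \<subseteq> A"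
  by (auto simp: toggle_def)

lemma inj_toggle: "inj (\<lambda>E. toggle E T)"
  by (metis injI toggle_toggle)

text \<open>Parity is additive under symmetric difference. The map \<open>f\<close> lets one lemma
  serve both degrees (\<open>f w = {v, w}\<close>) and edge counts (\<open>f\<close> the
  identity).\<close>

lemma even_card_toggle:
  assumes "finite S"
  shows "even (card {s \<in> S. f s \<in> toggle E T}) \<longleftrightarrow>
    (even (card {s \<in> S. f s \<in> E}) \<longleftrightarrow> even (card {s \<in> S. f s \<in> T}))"
  using assms
proof (induction S)
  case (insert x S)
  have *: "card {s \<in> insert x S. f s \<in> F} = (if f x \<in> F then 1 else 0) + card {s \<in> S. f s \<in> F}"
    for F
  proof -
    have "{s \<in> insert x S. f s \<in> F} =
      (if f x \<in> F then insert x {s \<in> S. f s \<in> F} else {s \<in> S. f s \<in> F})" by auto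
    then show ?thesis using insert by simp
  qed
  show ?case unfolding * using insert.IH by auto
qed simp

text \<open>Leaving \<open>v\<close> out of \<open>R\<close> makes the count independent of whether
  \<open>v\<close> itself is still present.\<close>

definition deg_in :: "'a set set \<Rightarrow> 'a set \<Rightarrow> 'a \<Rightarrow> nat" where
  "deg_in E R v = card {w \<in> R - {v}. {v, w} \<in> E}"

lemma even_deg_in_toggle:
  assumes "finite R"
  shows "even (deg_in (toggle E T) R v) \<longleftrightarrow>
    (even (deg_in E R v) \<longleftrightarrow> even (card {w \<in> R - {v}. {v, w} \<in> T}))"
  unfolding deg_in_def using assms by (intro even_card_toggle) auto

text \<open>
  Toggling \<open>arm z x w\<close> randomises the adjacency of \<open>x\<close> and \<open>w\<close> while the parity of the degree of
  \<open>x\<close> is kept, the edge to the root \<open>z\<close> compensating.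
\<close>

definition arm :: "'a \<Rightarrow> 'a \<Rightarrow> 'a \<Rightarrow> 'a set set" where
  "arm z x w = {{x, w}, {x, z}}"

lemma arm_meets:
  assumes "x \<noteq> w" "x \<noteq> z" "w \<noteq> z"
  shows "{u \<in> R - {v}. {v, u} \<in> arm z x w} =
    (if v = x then {w, z} \<inter> R else if v = w \<or> v = z then {x} \<inter> R else {})"
  using assms by (auto simp: arm_def doubleton_eq_iff)

text \<open>At \<open>x\<close> the two toggled edges cancel when \<open>w\<close> and
  \<open>z\<close> are both present; at \<open>w\<close> and \<open>z\<close> the toggled edge is
  not seen when \<open>x\<close> is absent; no other vertex meets the arm.\<close>

lemma deg_in_arm_same:
  assumes "finite R" "x \<noteq> w" "x \<noteq> z" "w \<noteq> z"
    and "v = x \<Longrightarrow> w \<in> R \<and> z \<in> R" "v = w \<or> v = z \<Longrightarrow> x \<notin> R"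
  shows "even (deg_in (toggle E (arm z x w)) R v) \<longleftrightarrow> even (deg_in E R v)"
  unfolding even_deg_in_toggle[OF assms(1)] arm_meets[OF assms(2-4)] using assms by auto

lemma deg_in_arm_flip_root:
  assumes "finite R" "x \<noteq> w" "x \<noteq> z" "w \<noteq> z" "w \<notin> R" "z \<in> R"
  shows "even (deg_in (toggle E (arm z x w)) R x) \<longleftrightarrow> odd (deg_in E R x)"
  unfolding even_deg_in_toggle[OF assms(1)] arm_meets[OF assms(2-4)] using assms by auto

lemma deg_in_arm_flip_end:
  assumes "finite R" "x \<noteq> w" "x \<noteq> z" "w \<noteq> z" "x \<in> R"
  shows "even (deg_in (toggle E (arm z x w)) R w) \<longleftrightarrow> odd (deg_in E R w)"
  unfolding even_deg_in_toggle[OF assms(1)] arm_meets[OF assms(2-4)] using assms by auto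

section \<open>Edge counts and elimination sequences\<close>

definition edges_in :: "'a set set \<Rightarrow> 'a set \<Rightarrow> nat" where
  "edges_in E R = card {e \<in> vertex_pairs R. e \<in> E}"

lemma vertex_pairs_remove:
  assumes "v \<in> R"
  shows "vertex_pairs R = vertex_pairs (R - {v}) \<union> (\<lambda>w. {v, w}) ` (R - {v})"
proof (rule set_eqI)
  fix e
  show "e \<in> vertex_pairs R \<longleftrightarrow> e \<in> vertex_pairs (R - {v}) \<union> (\<lambda>w. {v, w}) ` (R - {v})"
  proof (cases "v \<in> e")
    case True
    then show ?thesis using assms
      by (auto simp: vertex_pairs_def card_2_iff doubleton_eq_iff)
  qed (auto simp: vertex_pairs_def)
qed

lemma edges_in_remove:
  assumes "finite R" "v \<in> R"
  shows "edges_in E R = edges_in E (R - {v}) + deg_in E R v"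
proof -
  have "{e \<in> vertex_pairs R. e \<in> E} = {e \<in> vertex_pairs (R - {v}). e \<in> E} \<union>
      (\<lambda>w. {v, w}) ` {w \<in> R - {v}. {v, w} \<in> E}"
    unfolding vertex_pairs_remove[OF assms(2)] by auto
  moreover have "card ((\<lambda>w. {v, w}) ` {w \<in> R - {v}. {v, w} \<in> E}) = deg_in E R v"
    unfolding deg_in_def by (intro card_image) (auto simp: inj_on_def doubleton_eq_iff)
  moreover have "finite {e \<in> vertex_pairs (R - {v}). e \<in> E}"
    using finite_vertex_pairs[of "R - {v}"] assms by simp
  moreover have "{e \<in> vertex_pairs (R - {v}). e \<in> E} \<inter>
      (\<lambda>w. {v, w}) ` {w \<in> R - {v}. {v, w} \<in> E} = {}"
    by (auto simp: vertex_pairs_def)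
  ultimately show ?thesis
    unfolding edges_in_def using assms(1) by (simp add: card_Un_disjoint)
qed

inductive elim :: "'a set set \<Rightarrow> 'a set \<Rightarrow> 'a set \<Rightarrow> bool" for E where
  refl [intro]: "elim E R R"
| step: "v \<in> R \<Longrightarrow> even (deg_in E R v) \<Longrightarrow> elim E (R - {v}) S \<Longrightarrow> elim E R S"

lemma elim_trans: "elim E R S \<Longrightarrow> elim E S T \<Longrightarrow> elim E R T"
  by (induction rule: elim.induct) (auto intro: elim.intros)

lemma elim_one: "v \<in> R \<Longrightarrow> even (deg_in E R v) \<Longrightarrow> elim E R (R - {v})"
  by (auto intro: elim.intros)

text \<open>Each deletion removes an even number of edges. This invariant forces the parity of the
  last vertex once all others have been dealt with.\<close>

lemma elim_parity: "elim E R S \<Longrightarrow> finite R \<Longrightarrow> even (edges_in E R) \<longleftrightarrow> even (edges_in E S)"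
  by (induction rule: elim.induct) (auto simp: edges_in_remove)

lemma elim_order:
  assumes "elim E R Z" "finite R" "card Z = 2"
  shows "\<exists>vs. distinct vs \<and> set vs = R \<and>
    (\<forall>i < length vs - 2. even (card {w \<in> set (drop (Suc i) vs). {vs ! i, w} \<in> E}))"
  using assms
proof (induction rule: elim.induct)
  case (refl R)
  from finite_distinct_list[OF refl(1)] obtain vs where "set vs = R" "distinct vs" by blast
  moreover have "length vs = 2" using calculation refl distinct_card by metis
  ultimately show ?case by (intro exI[of _ vs]) auto
next
  case (step v R S)
  then obtain vs where vs: "distinct vs" "set vs = R - {v}"
    "\<forall>i < length vs - 2. even (card {w \<in> set (drop (Suc i) vs). {vs ! i, w} \<in> E})" by auto
  have "even (card {w \<in> set (drop (Suc i) (v # vs)). {(v # vs) ! i, w} \<in> E})"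
    if "i < length (v # vs) - 2" for i
    using that vs step(2) by (cases i) (auto simp: deg_in_def)
  then show ?case using vs step(1) by (intro exI[of _ "v # vs"]) auto
qed

lemma elim_even_degenerate:
  assumes "elim E V Z" "finite V" "card Z = 2"
  shows "even_degenerate V E"
proof -
  obtain vs where vs: "distinct vs" "set vs = V"
    "\<And>i. i < length vs - 2 \<Longrightarrow> even (card {w \<in> set (drop (Suc i) vs). {vs ! i, w} \<in> E})"
    using elim_order[OF assms] by blast
  have len: "length vs = card V" using vs distinct_card by metis
  \<comment> \<open>The ordering in \<open>even_degenerate\<close> starts at 1, lists start at
    0.\<close>
  let ?v = "\<lambda>i. vs ! (i - 1)"
  have bij: "bij_betw ?v {1..card V} V"
  proof -
    have "bij_betw (\<lambda>i::nat. i - 1) {1..card V} {..<card V}"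
      by (rule bij_betwI[of _ _ _ Suc]) auto
    moreover have "bij_betw ((!) vs) {..<card V} V"
      using vs len by (intro bij_betw_nth) auto
    ultimately have "bij_betw ((!) vs \<circ> (\<lambda>i::nat. i - 1)) {1..card V} V"
      by (rule bij_betw_trans)
    then show ?thesis unfolding comp_def .
  qed
  have drop: "?v ` {i+1..card V} = set (drop i vs)" if "1 \<le> i" for i
  proof -
    have "set (drop i vs) = (!) vs ` {i..<length vs}"
    proof -
      have "drop i vs = map ((!) vs) [i..<length vs]"
        by (rule nth_equalityI) auto
      then show ?thesis by simp
    qed
    moreover have "(\<lambda>i::nat. i - 1) ` {i+1..card V} = {i..<length vs}"
    proof
      show "{i..<length vs} \<subseteq> (\<lambda>i::nat. i - 1) ` {i+1..card V}"
      proof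
        fix j assume "j \<in> {i..<length vs}"
        then have "j = Suc j - 1" "Suc j \<in> {i+1..card V}" using len by auto
        then show "j \<in> (\<lambda>i::nat. i - 1) ` {i+1..card V}" by (rule image_eqI)
      qed
      show "(\<lambda>i::nat. i - 1) ` {i+1..card V} \<subseteq> {i..<length vs}"
        using len by auto
    qed
    moreover have "?v ` {i+1..card V} = (!) vs ` (\<lambda>i::nat. i - 1) ` {i+1..card V}"
      unfolding image_image ..
    ultimately show ?thesis by metis
  qed
  show ?thesis unfolding even_degenerate_def
  proof (intro exI[of _ ?v] conjI bij allI impI)
    fix i :: nat assume i: "1 \<le> i \<and> i \<le> card V - 2"
    then have "Suc (i - 1) = i" "i - 1 < length vs - 2" using len by auto
    then have "even (card {w \<in> set (drop i vs). {?v i, w} \<in> E})"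
      using vs(3)[of "i - 1"] by simp
    then show "even (card {w \<in> ?v ` {i+1..card V}. {?v i, w} \<in> E})"
      using drop[of i] i by simp
  qed
qed

section \<open>One pass of deletions through a list of vertices\<close>

fun sweep :: "'a set set \<Rightarrow> 'a set \<Rightarrow> 'a set \<Rightarrow> 'a list \<Rightarrow> 'a set" where
  "sweep E B X [] = X"
| "sweep E B X (x # xs) = sweep E B (if even (deg_in E (X \<union> B) x) then X - {x} else X) xs"

lemma sweep_append: "sweep E B X (xs @ ys) = sweep E B (sweep E B X xs) ys"
  by (induction xs arbitrary: X) auto

lemma sweep_subset: "sweep E B X xs \<subseteq> X"
proof (induction xs arbitrary: X)
  case (Cons x xs)
  from Cons[of X] Cons[of "X - {x}"] show ?case by auto
qed simp

lemma sweep_other: "y \<notin> set xs \<Longrightarrow> y \<in> sweep E B X xs \<longleftrightarrow> y \<in> X"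
  by (induction xs arbitrary: X) auto

lemma sweep_cong:
  assumes "\<And>x Y. x \<in> set xs \<Longrightarrow> Y \<subseteq> X \<Longrightarrow>
    even (deg_in E (Y \<union> B) x) \<longleftrightarrow> even (deg_in E' (Y \<union> B) x)"
  shows "sweep E B X xs = sweep E' B X xs"
  using assms
proof (induction xs arbitrary: X)
  case (Cons x xs)
  have "sweep E B Y xs = sweep E' B Y xs" if "Y \<subseteq> X" for Y
    using that by (intro Cons) auto
  then show ?case using Cons(2)[of x X] by auto
qed simp

text \<open>Without repetitions \<open>x\<close> is examined only once, so its fate is its parity at
  that moment and \<open>post\<close> cannot change it.\<close>

lemma sweep_mem:
  assumes "distinct (pre @ x # post)" "x \<in> X"
  shows "x \<in> sweep E B X (pre @ x # post) \<longleftrightarrow> odd (deg_in E (sweep E B X pre \<union> B) x)"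
  using assms by (auto simp: sweep_append sweep_other)

lemma sweep_elim:
  assumes "distinct xs" "set xs \<subseteq> X" "X \<inter> B = {}"
  shows "elim E (X \<union> B) (sweep E B X xs \<union> B)"
  using assms
proof (induction xs arbitrary: X)
  case (Cons x xs)
  have "elim E (X \<union> B) (X - {x} \<union> B)" if "even (deg_in E (X \<union> B) x)"
  proof -
    have "X \<union> B - {x} = X - {x} \<union> B" using Cons.prems by auto
    then show ?thesis using elim_one[of x "X \<union> B" E] that Cons.prems by auto
  qed
  moreover have "elim E (X - {x} \<union> B) (sweep E B (X - {x}) xs \<union> B)"
    using Cons.prems by (intro Cons.IH) auto
  moreover have "elim E (X \<union> B) (sweep E B X xs \<union> B)"
    using Cons.prems by (intro Cons.IH) auto
  ultimately show ?case using elim_trans by auto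
qed auto

section \<open>Weights of bounded ratio and one step along the chain\<close>

text \<open>\<open>sum \<omega> \<Omega>\<close> plays the role of an unnormalised probability. The
  linear order of the vertices fixes the order of sweeps and of the chain.\<close>

locale flip_weight =
  fixes V :: "'a::linorder set" and \<omega> :: "'a set set \<Rightarrow> real" and \<rho> :: real
  assumes finite_V: "finite V" and rho: "1 \<le> \<rho>"
    and weight_nonneg: "E \<subseteq> vertex_pairs V \<Longrightarrow> 0 \<le> \<omega> E"
    and weight_flip: "E \<subseteq> vertex_pairs V \<Longrightarrow> e \<in> vertex_pairs V \<Longrightarrow> \<omega> E \<le> \<rho> * \<omega> (toggle E {e})"
begin

lemma weight_toggle:
  assumes "T \<subseteq> vertex_pairs V" "E \<subseteq> vertex_pairs V"
  shows "\<omega> E \<le> \<rho> ^ card T * \<omega> (toggle E T)"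
proof -
  have "finite T" using assms(1) finite_vertex_pairs[OF finite_V] finite_subset by blast
  then show ?thesis using assms
  proof (induction T)
    case (insert e T)
    have *: "toggle E (insert e T) = toggle (toggle E T) {e}"
      using insert.hyps by (subst toggle_Un) auto
    have "\<omega> E \<le> \<rho> ^ card T * \<omega> (toggle E T)" using insert by simp
    also have "\<omega> (toggle E T) \<le> \<rho> * \<omega> (toggle E (insert e T))"
      unfolding * using insert by (intro weight_flip toggle_subset) auto
    finally show ?case using rho insert.hyps by (simp add: mult.assoc mult.left_commute)
  qed simp
qed

lemma finite_graphs: "\<Omega> \<subseteq> Pow (vertex_pairs V) \<Longrightarrow> finite \<Omega>"
  using finite_vertex_pairs[OF finite_V] finite_subset by blast

lemma mass_nonneg: "\<Omega> \<subseteq> Pow (vertex_pairs V) \<Longrightarrow> 0 \<le> sum \<omega> \<Omega>"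
  by (rule sum_nonneg) (use weight_nonneg in blast)

lemma mass_mono: "\<Omega> \<subseteq> Pow (vertex_pairs V) \<Longrightarrow> \<Omega>' \<subseteq> \<Omega> \<Longrightarrow> sum \<omega> \<Omega>' \<le> sum \<omega> \<Omega>"
  by (rule sum_mono2[OF finite_graphs]) (use weight_nonneg in auto)

text \<open>Substitute for a lower bound on a conditional probability: every graph of
  \<open>\<Omega>\<close> is charged to a good graph that some \<open>T \<in> F\<close> leads to.
  Toggling \<open>T\<close> is injective, so a good graph is charged at most once per
  \<open>T\<close>, with a factor of at most \<open>\<rho> ^ r\<close>.\<close>

lemma mass_le_reachable:
  assumes \<Omega>: "\<Omega> \<subseteq> Pow (vertex_pairs V)" and fin: "finite F"
    and F: "\<And>T. T \<in> F \<Longrightarrow> T \<subseteq> vertex_pairs V \<and> card T \<le> r"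
    and reach: "\<And>E. E \<in> \<Omega> \<Longrightarrow> \<exists>T\<in>F. toggle E T \<in> \<Omega> \<and> Q (toggle E T)"
  shows "sum \<omega> \<Omega> \<le> real (card F) * \<rho> ^ r * sum \<omega> {E \<in> \<Omega>. Q E}"
proof -
  let ?G = "{E \<in> \<Omega>. Q E}"
  note fin\<Omega> = finite_graphs[OF \<Omega>]
  have "\<omega> E \<le> (\<Sum>T\<in>F. if toggle E T \<in> ?G then \<rho> ^ r * \<omega> (toggle E T) else 0)"
    if E: "E \<in> \<Omega>" for E
  proof -
    from reach[OF E] obtain T where T: "T \<in> F" "toggle E T \<in> ?G" by auto
    have EV: "E \<subseteq> vertex_pairs V" using E \<Omega> by auto
    have "\<omega> E \<le> \<rho> ^ card T * \<omega> (toggle E T)" using F[OF T(1)] EV by (intro weight_toggle) auto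
    also have "\<dots> \<le> \<rho> ^ r * \<omega> (toggle E T)"
      using F[OF T(1)] EV rho
      by (intro mult_right_mono power_increasing weight_nonneg toggle_subset) auto
    also have "\<dots> = (\<Sum>T\<in>{T}. if toggle E T \<in> ?G then \<rho> ^ r * \<omega> (toggle E T) else 0)"
      using T by simp
    also have "\<dots> \<le> (\<Sum>T\<in>F. if toggle E T \<in> ?G then \<rho> ^ r * \<omega> (toggle E T) else 0)"
      using fin T rho \<Omega> by (intro sum_mono2) (auto intro!: mult_nonneg_nonneg weight_nonneg)
    finally show ?thesis .
  qed
  then have "sum \<omega> \<Omega> \<le> (\<Sum>E\<in>\<Omega>. \<Sum>T\<in>F. if toggle E T \<in> ?G then \<rho> ^ r * \<omega> (toggle E T) else 0)"
    by (rule sum_mono)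
  also have "\<dots> = (\<Sum>T\<in>F. \<Sum>E\<in>\<Omega>. if toggle E T \<in> ?G then \<rho> ^ r * \<omega> (toggle E T) else 0)"
    by (rule sum.swap)
  also have "\<dots> \<le> (\<Sum>T\<in>F. \<rho> ^ r * sum \<omega> ?G)"
  proof (rule sum_mono)
    fix T
    let ?S = "{E \<in> \<Omega>. toggle E T \<in> ?G}"
    have "(\<Sum>E\<in>\<Omega>. if toggle E T \<in> ?G then \<rho> ^ r * \<omega> (toggle E T) else 0) =
        (\<Sum>E\<in>?S. \<rho> ^ r * \<omega> (toggle E T))"
      using fin\<Omega> by (simp add: sum.If_cases Int_def conj_ac)
    also have "\<dots> = \<rho> ^ r * (\<Sum>E\<in>?S. \<omega> (toggle E T))" by (simp add: sum_distrib_left)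
    also have "(\<Sum>E\<in>?S. \<omega> (toggle E T)) = sum \<omega> ((\<lambda>E. toggle E T) ` ?S)"
      by (subst sum.reindex) (auto intro: inj_on_subset[OF inj_toggle])
    also have "\<rho> ^ r * \<dots> \<le> \<rho> ^ r * sum \<omega> ?G"
      using rho \<Omega> by (intro mult_left_mono mass_mono) auto
    finally show "(\<Sum>E\<in>\<Omega>. if toggle E T \<in> ?G then \<rho> ^ r * \<omega> (toggle E T) else 0)
        \<le> \<rho> ^ r * sum \<omega> ?G" .
  qed
  also have "\<dots> = real (card F) * \<rho> ^ r * sum \<omega> ?G" by simp
  finally show ?thesis .
qed

end

section \<open>A single step along the chain\<close>

lemma arm_Union_toggle:
  assumes "x \<notin> N" "z \<notin> insert x N" "w \<notin> insert x N"
  shows "toggle (toggle E (\<Union>y\<in>N. arm z y w)) (arm z x w) = toggle E (\<Union>y\<in>insert x N. arm z y w)"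
  using assms by (subst toggle_Un) (auto simp: arm_def doubleton_eq_iff)

definition advance :: "'a::linorder set set \<Rightarrow> 'a set \<Rightarrow> 'a \<Rightarrow> 'a set \<Rightarrow> 'a set" where
  "advance E B w X =
    (if even (deg_in E (insert w (X \<union> B)) w) then sweep E B X (sorted_list_of_set X)
     else insert w X)"

lemma advance_elim:
  assumes "finite X" "X \<inter> B = {}" "w \<notin> X" "w \<notin> B"
  shows "elim E (insert w (X \<union> B)) (advance E B w X \<union> B)"
proof (cases "even (deg_in E (insert w (X \<union> B)) w)")
  case True
  have "elim E (insert w (X \<union> B)) (X \<union> B)"
    using elim_one[OF _ True] assms by simp
  moreover have "elim E (X \<union> B) (sweep E B X (sorted_list_of_set X) \<union> B)"
    using assms by (intro sweep_elim) auto
  ultimately show ?thesis using True by (auto simp: advance_def intro: elim_trans)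
qed (auto simp: advance_def)

lemma advance_subset: "advance E B w X \<subseteq> insert w X"
  using sweep_subset[of E B X] by (auto simp: advance_def)

text \<open>Repair the sweep from left to right: whenever the next vertex \<open>x\<close> would
  stay, toggle its arm. During the sweep \<open>z\<close> is present and \<open>w\<close> absent, so
  this flips \<open>x\<close>, and no vertex swept earlier meets the arm.\<close>

lemma sweep_arm_reach:
  assumes fin: "finite X" "finite B" and z: "z \<in> B" "w \<notin> X" "w \<notin> B" "X \<inter> B = {}"
    and closed: "\<And>E x. E \<in> \<Omega> \<Longrightarrow> x \<in> X \<Longrightarrow> toggle E (arm z x w) \<in> \<Omega>"
    and "distinct xs" "set xs \<subseteq> X" "E \<in> \<Omega>"
  shows "\<exists>N \<subseteq> set xs. toggle E (\<Union>y\<in>N. arm z y w) \<in> \<Omega> \<and>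
    sweep (toggle E (\<Union>y\<in>N. arm z y w)) B X xs = X - set xs"
  using assms(8-10)
proof (induction xs rule: rev_induct)
  case Nil
  then show ?case by (intro exI[of _ "{}"]) auto
next
  case (snoc x xs)
  then obtain N where N: "N \<subseteq> set xs" "toggle E (\<Union>y\<in>N. arm z y w) \<in> \<Omega>"
    "sweep (toggle E (\<Union>y\<in>N. arm z y w)) B X xs = X - set xs" by auto
  let ?E = "toggle E (\<Union>y\<in>N. arm z y w)"
  let ?E' = "toggle ?E (arm z x w)"
  have x: "x \<in> X" "x \<notin> set xs" using snoc by auto
  have neq: "x \<noteq> w" "x \<noteq> z" "w \<noteq> z" using z x by auto
  show ?case
  proof (cases "even (deg_in ?E (X - set xs \<union> B) x)")
    case True
    then show ?thesis using N by (intro exI[of _ N]) (auto simp: sweep_append)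
  next
    case False
    have E': "?E' = toggle E (\<Union>y\<in>insert x N. arm z y w)"
      using N x z snoc by (intro arm_Union_toggle) auto
    have "sweep ?E' B X xs = sweep ?E B X xs"
      using fin x z neq snoc.prems
      by (intro sweep_cong deg_in_arm_same) (auto dest: finite_subset)
    moreover have "even (deg_in ?E' (X - set xs \<union> B) x)"
      using False fin neq z by (subst deg_in_arm_flip_root) auto
    ultimately have "sweep ?E' B X (xs @ [x]) = X - set (xs @ [x])"
      using N by (auto simp: sweep_append)
    moreover have "?E' \<in> \<Omega>" using closed N x by blast
    ultimately show ?thesis unfolding E' using N by (intro exI[of _ "insert x N"]) auto
  qed
qed

context flip_weight
begin

lemma arm_subset: "x \<in> V \<Longrightarrow> w \<in> V \<Longrightarrow> z \<in> V \<Longrightarrow> x \<noteq> w \<Longrightarrow> x \<noteq> z \<Longrightarrow> arm z x w \<subseteq> vertex_pairs V"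
  by (auto simp: arm_def vertex_pairs_def)

lemma card_arm_le: "card (arm z x w) \<le> 2"
  unfolding arm_def by (rule card_insert_le_m1) auto

context
  fixes X B :: "'a set" and z w :: 'a and \<Omega> :: "'a set set set"
  assumes \<Omega>: "\<Omega> \<subseteq> Pow (vertex_pairs V)" and XV: "X \<subseteq> V" and BV: "B \<subseteq> V" and wV: "w \<in> V"
    and zB: "z \<in> B" and wX: "w \<notin> X" and wB: "w \<notin> B" and XB: "X \<inter> B = {}"
    and closed: "\<And>E x. E \<in> \<Omega> \<Longrightarrow> x \<in> X \<Longrightarrow> toggle E (arm z x w) \<in> \<Omega>"
begin

lemma fin_XB: "finite X" "finite B"
  using XV BV finite_V finite_subset by blast+

text \<open>At most \<open>2 ^ card X\<close> sets of arms, each with at most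
  \<open>2 * card X\<close> edges, have to be tried to make the sweep remove all of
  \<open>X\<close>.\<close>

lemma advance_empty_mass:
  assumes par: "\<And>E. E \<in> \<Omega> \<Longrightarrow> even (edges_in E (insert w (X \<union> B))) \<longleftrightarrow> even (edges_in E B)"
  shows "sum \<omega> \<Omega> \<le> (2 * \<rho>\<^sup>2) ^ card X * sum \<omega> {E \<in> \<Omega>. advance E B w X = {}}"
proof -
  let ?T = "\<lambda>N. \<Union>y\<in>N. arm z y w"
  let ?F = "?T ` Pow X"
  have "sum \<omega> \<Omega> \<le> real (card ?F) * \<rho> ^ (2 * card X) * sum \<omega> {E \<in> \<Omega>. advance E B w X = {}}"
  proof (rule mass_le_reachable[OF \<Omega>])
    fix T assume "T \<in> ?F"
    then obtain N where N: "N \<subseteq> X" "T = ?T N" by auto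
    have "card T \<le> (\<Sum>y\<in>N. card (arm z y w))"
      unfolding N using N fin_XB finite_subset by (intro card_UN_le) auto
    also have "\<dots> \<le> (\<Sum>y\<in>N. 2)" by (intro sum_mono card_arm_le)
    also have "\<dots> \<le> 2 * card X" using card_mono[OF fin_XB(1) N(1)] by simp
    finally have "card T \<le> 2 * card X" .
    moreover have "arm z y w \<subseteq> vertex_pairs V" if "y \<in> N" for y
      using N that XV BV wV zB wX XB by (intro arm_subset) auto
    ultimately show "T \<subseteq> vertex_pairs V \<and> card T \<le> 2 * card X" unfolding N by auto
  next
    fix E assume E: "E \<in> \<Omega>"
    obtain N where N: "N \<subseteq> X" "toggle E (?T N) \<in> \<Omega>"
      "sweep (toggle E (?T N)) B X (sorted_list_of_set X) = {}"
      using sweep_arm_reach[OF fin_XB zB wX wB XB closed, where xs = "sorted_list_of_set X" and E = E] E fin_XB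
      by auto
    let ?E = "toggle E (?T N)"
    \<comment> \<open>The sweep keeps the edge parity on the way from \<open>X \<union> B\<close> to
      \<open>B\<close>; comparison with \<open>par\<close> leaves an even degree for
      \<open>w\<close>, so the sweep is indeed carried out.\<close>
    have "elim ?E (X \<union> B) B"
      using sweep_elim[of "sorted_list_of_set X" X B ?E] N fin_XB XB by auto
    then have "even (edges_in ?E (X \<union> B)) \<longleftrightarrow> even (edges_in ?E B)"
      using fin_XB by (intro elim_parity) auto
    moreover have "edges_in ?E (insert w (X \<union> B)) =
        edges_in ?E (X \<union> B) + deg_in ?E (insert w (X \<union> B)) w"
      using edges_in_remove[of "insert w (X \<union> B)" w ?E] fin_XB wX wB by simp
    ultimately have "even (deg_in ?E (insert w (X \<union> B)) w)"
      using par[OF N(2)] by auto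
    then have "advance ?E B w X = {}" using N by (simp add: advance_def)
    then show "\<exists>T\<in>?F. toggle E T \<in> \<Omega> \<and> advance (toggle E T) B w X = {}"
      using N by blast
  qed (use fin_XB in auto)
  also have "\<dots> \<le> 2 ^ card X * \<rho> ^ (2 * card X) * sum \<omega> {E \<in> \<Omega>. advance E B w X = {}}"
  proof (intro mult_right_mono)
    have "card ?F \<le> card (Pow X)" using fin_XB by (intro card_image_le) auto
    then show "real (card ?F) \<le> 2 ^ card X" using fin_XB by (simp add: card_Pow)
  qed (use rho \<Omega> in \<open>auto intro!: mass_nonneg\<close>)
  finally show ?thesis by (simp add: power_mult_distrib power_mult)
qed

text \<open>The arm of \<open>x\<close> decides whether \<open>x\<close> is swept away, and the arm
  of \<open>l\<close> corrects the parity of \<open>w\<close>. As \<open>l\<close> is examined last,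
  the change of its own fate disturbs no other vertex.\<close>

lemma advance_drop_mass:
  assumes xs: "sorted_list_of_set X = xs @ [l]" and x: "x \<in> set xs"
  shows "sum \<omega> \<Omega> \<le> 4 * \<rho> ^ 4 *
    sum \<omega> {E \<in> \<Omega>. even (deg_in E (insert w (X \<union> B)) w) \<and> x \<notin> sweep E B X (xs @ [l])}"
proof -
  let ?Q = "\<lambda>E. even (deg_in E (insert w (X \<union> B)) w) \<and> x \<notin> sweep E B X (xs @ [l])"
  let ?F = "{{}, arm z x w, arm z l w, arm z x w \<union> arm z l w}"
  have dist: "distinct (xs @ [l])" and set: "set (xs @ [l]) = X"
    unfolding xs[symmetric] using fin_XB by auto
  have lX: "l \<in> X" "x \<in> X" "x \<noteq> l" using set dist x by auto
  obtain pre post where split: "xs = pre @ x # post" using x split_list by metis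
  have disj: "arm z x w \<inter> arm z l w = {}"
    using lX zB wX wB XB by (auto simp: arm_def doubleton_eq_iff)
  have neq: "y \<noteq> w" "y \<noteq> z" "w \<noteq> z" if "y \<in> X" for y using that zB wX wB XB by auto
  have mem: "x \<in> sweep E B X (xs @ [l]) \<longleftrightarrow> odd (deg_in E (sweep E B X pre \<union> B) x)" for E
    using sweep_mem[of pre x "post @ [l]" X E B] dist lX split by simp
  have pre_same: "sweep (toggle E (arm z y w)) B X pre = sweep E B X pre"
    if "y \<in> X" "y \<notin> set pre" for E y
    using that fin_XB neq zB wX wB XB dist set split
    by (intro sweep_cong deg_in_arm_same) (auto dest: finite_subset)
  have fin_pre: "finite (sweep E B X pre \<union> B)" for E
    using fin_XB finite_subset[OF sweep_subset[of E B X pre]] by simp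
  have x_flip: "x \<in> sweep (toggle E (arm z x w)) B X (xs @ [l]) \<longleftrightarrow>
      x \<notin> sweep E B X (xs @ [l])" for E
  proof -
    have "w \<notin> sweep E B X pre \<union> B" using sweep_subset[of E B X pre] wX wB by blast
    then show ?thesis
      unfolding mem using pre_same[of x E] lX dist split fin_pre neq[of x] zB
      by (simp add: deg_in_arm_flip_root)
  qed
  have x_same: "x \<in> sweep (toggle E (arm z l w)) B X (xs @ [l]) \<longleftrightarrow>
      x \<in> sweep E B X (xs @ [l])" for E
    unfolding mem using pre_same[of l E] lX dist split fin_pre neq[of l] neq[of x] zB
    by (subst deg_in_arm_same) (auto)
  have w_flip: "even (deg_in (toggle E (arm z l w)) (insert w (X \<union> B)) w) \<longleftrightarrow>
      odd (deg_in E (insert w (X \<union> B)) w)" for E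
    using lX neq[of l] fin_XB by (intro deg_in_arm_flip_end) auto
  have sub: "arm z y w \<subseteq> vertex_pairs V" if "y \<in> X" for y
    using that neq XV BV wV zB by (intro arm_subset) auto
  have "sum \<omega> \<Omega> \<le> real (card ?F) * \<rho> ^ 4 * sum \<omega> {E \<in> \<Omega>. ?Q E}"
  proof (rule mass_le_reachable[OF \<Omega>])
    fix T assume "T \<in> ?F"
    then show "T \<subseteq> vertex_pairs V \<and> card T \<le> 4"
      using sub[OF lX(1)] sub[OF lX(2)] card_arm_le[of z x w] card_arm_le[of z l w]
        card_Un_le[of "arm z x w" "arm z l w"] by auto
  next
    fix E assume E: "E \<in> \<Omega>"
    define T where "T = (if x \<in> sweep E B X (xs @ [l]) then arm z x w else {})"
    define T' where "T' = (if odd (deg_in (toggle E T) (insert w (X \<union> B)) w) then arm z l w else {})"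
    have T: "toggle E T \<in> \<Omega>" "x \<notin> sweep (toggle E T) B X (xs @ [l])"
      using E closed lX x_flip by (auto simp: T_def)
    have "toggle (toggle E T) T' \<in> \<Omega>" "?Q (toggle (toggle E T) T')"
      using T closed lX x_same w_flip by (auto simp: T'_def)
    moreover have "toggle (toggle E T) T' = toggle E (T \<union> T')"
      using disj by (intro toggle_Un) (auto simp: T_def T'_def)
    moreover have "T \<union> T' \<in> ?F" by (auto simp: T_def T'_def)
    ultimately show "\<exists>T\<in>?F. toggle E T \<in> \<Omega> \<and> ?Q (toggle E T)" by metis
  qed simp
  also have "\<dots> \<le> 4 * \<rho> ^ 4 * sum \<omega> {E \<in> \<Omega>. ?Q E}"
  proof (intro mult_right_mono)
    have "card ?F \<le> 4" by (simp add: card_insert_if)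
    then show "real (card ?F) \<le> 4" by simp
  qed (use rho \<Omega> in \<open>auto intro!: mass_nonneg\<close>)
  finally show ?thesis .
qed

end

end


context flip_weight
begin

text \<open>
  With \<open>c = 1 / (4 * \<rho> ^ 4)\<close> the bound below on the probability that a single vertex is swept away,
  \<open>6 / c\<close> is a size from which on \<open>c * card X\<close> outweighs the vertex that may join \<open>X\<close>.
\<close>

definition small_size :: nat where
  "small_size = nat \<lceil>24 * \<rho> ^ 4\<rceil>"

text \<open>Lower bound, by \<open>advance_empty_mass\<close>, on the probability that a set of at
  most \<open>small_size\<close> vertices is emptied in one step.\<close>

definition hit_rate :: real where
  "hit_rate = 1 / (2 * \<rho>\<^sup>2) ^ small_size"

text \<open>Emptying \<open>X\<close> gains \<open>hit_rate * offset = 2\<close> on average: one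
  unit pays for the vertex that may join \<open>X\<close>, the other is the required decay of the
  offset itself.\<close>

definition offset :: real where
  "offset = 2 / hit_rate"

definition decay :: real where
  "decay = 1 - hit_rate / 2"

lemma small_size_ge: "24 * \<rho> ^ 4 \<le> real small_size" and small_size_pos: "2 \<le> small_size"
proof -
  have "1 \<le> \<rho> ^ 4" using rho by simp
  then show "24 * \<rho> ^ 4 \<le> real small_size" unfolding small_size_def by linarith
  with \<open>1 \<le> \<rho> ^ 4\<close> show "2 \<le> small_size" by linarith
qed

lemma two_rho: "1 \<le> \<rho>\<^sup>2" "1 \<le> 2 * \<rho>\<^sup>2"
proof -
  show "1 \<le> \<rho>\<^sup>2" using rho by simp
  then show "1 \<le> 2 * \<rho>\<^sup>2" by linarith
qed

text \<open>The upper bound lets one value of \<open>decay\<close> serve for small and for large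
  \<open>X\<close>; it holds because \<open>small_size\<close> is at least 2.\<close>

lemma hit_rate_pos: "0 < hit_rate" and hit_rate_le: "hit_rate \<le> 1 / (4 * \<rho> ^ 4)"
proof -
  have "0 < (2 * \<rho>\<^sup>2) ^ small_size" using two_rho by (intro zero_less_power) linarith
  then show "0 < hit_rate" unfolding hit_rate_def by simp
  have "4 * \<rho> ^ 4 = (2 * \<rho>\<^sup>2)\<^sup>2" by (simp add: power2_eq_square power4_eq_xxxx)
  also have "\<dots> \<le> (2 * \<rho>\<^sup>2) ^ small_size" using two_rho small_size_pos by (intro power_increasing) auto
  finally show "hit_rate \<le> 1 / (4 * \<rho> ^ 4)" unfolding hit_rate_def
    using rho by (intro divide_left_mono) auto
qed

lemma hit_rate_le_one: "hit_rate \<le> 1 / 4"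
proof -
  have "1 \<le> \<rho> ^ 4" using rho by simp
  then have "1 / (4 * \<rho> ^ 4) \<le> 1 / 4" by (intro divide_left_mono) auto
  then show ?thesis using hit_rate_le by linarith
qed

lemma decay_bounds: "0 < decay" "decay < 1"
  using hit_rate_pos hit_rate_le_one by (auto simp: decay_def)

lemma offset_ge: "1 \<le> offset"
  using hit_rate_pos hit_rate_le_one by (simp add: offset_def field_simps)

lemma offset_hit_rate: "hit_rate * offset = 2"
  using hit_rate_pos by (simp add: offset_def)

text \<open>
  The potential \<open>card X + offset\<close> shrinks by the factor \<open>decay\<close> on average: for large \<open>X\<close>
  because every vertex but the last is swept away with probability bounded below, for small
  \<open>X\<close> because \<open>X\<close> vanishes altogether with probability at least \<open>hit_rate\<close>.
\<close>

lemma advance_potential: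
  fixes X B :: "'a set" and z w :: 'a and \<Omega> :: "'a set set set"
  assumes \<Omega>: "\<Omega> \<subseteq> Pow (vertex_pairs V)" and XV: "X \<subseteq> V" and BV: "B \<subseteq> V" and wV: "w \<in> V"
    and zB: "z \<in> B" and wX: "w \<notin> X" and wB: "w \<notin> B" and XB: "X \<inter> B = {}"
    and closed: "\<And>E x. E \<in> \<Omega> \<Longrightarrow> x \<in> X \<Longrightarrow> toggle E (arm z x w) \<in> \<Omega>"
    and par: "\<And>E. E \<in> \<Omega> \<Longrightarrow> even (edges_in E (insert w (X \<union> B))) \<longleftrightarrow> even (edges_in E B)"
  shows "(\<Sum>E\<in>{E \<in> \<Omega>. advance E B w X \<noteq> {}}. \<omega> E * (real (card (advance E B w X)) + offset))
    \<le> decay * (real (card X) + offset) * sum \<omega> \<Omega>"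
proof -
  note fin\<Omega> = finite_graphs[OF \<Omega>]
  have finX: "finite X" using XV finite_V finite_subset by blast
  have w_nonneg: "0 \<le> \<omega> E" if "E \<in> \<Omega>" for E using that \<Omega> weight_nonneg by auto
  have M: "0 \<le> sum \<omega> \<Omega>" using \<Omega> by (rule mass_nonneg)
  let ?x = "real (card X)"
  let ?A = "\<lambda>E. advance E B w X"
  have card_le: "real (card (?A E)) \<le> ?x + 1" for E
  proof -
    have "card (?A E) \<le> card (insert w X)" using finX advance_subset[of E B w X] by (intro card_mono) auto
    then show ?thesis using finX wX by simp
  qed
  show ?thesis
  proof (cases "card X \<le> small_size")
    case True
    let ?H = "sum \<omega> {E \<in> \<Omega>. ?A E = {}}"
    have H0: "0 \<le> ?H" using \<Omega> by (intro mass_nonneg) auto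
    have "sum \<omega> \<Omega> \<le> (2 * \<rho>\<^sup>2) ^ card X * ?H"
      using assms by (intro advance_empty_mass)
    also have "\<dots> \<le> (2 * \<rho>\<^sup>2) ^ small_size * ?H"
      using True two_rho H0 by (intro mult_right_mono power_increasing)
    finally have le: "sum \<omega> \<Omega> \<le> (2 * \<rho>\<^sup>2) ^ small_size * ?H" .
    have pos: "0 < (2 * \<rho>\<^sup>2) ^ small_size"
      using two_rho by (intro zero_less_power) linarith
    have "sum \<omega> \<Omega> / (2 * \<rho>\<^sup>2) ^ small_size \<le> ?H"
      using le unfolding pos_divide_le_eq[OF pos] by (simp only: mult.commute)
    then have H: "hit_rate * sum \<omega> \<Omega> \<le> ?H" by (simp add: hit_rate_def)
    have split: "sum \<omega> \<Omega> = ?H + sum \<omega> {E \<in> \<Omega>. ?A E \<noteq> {}}"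
      using fin\<Omega> by (subst sum.union_disjoint[symmetric]) (auto intro: sum.cong)
    have "(\<Sum>E\<in>{E \<in> \<Omega>. ?A E \<noteq> {}}. \<omega> E * (real (card (?A E)) + offset))
        \<le> (\<Sum>E\<in>{E \<in> \<Omega>. ?A E \<noteq> {}}. \<omega> E * (?x + 1 + offset))"
      using w_nonneg card_le by (intro sum_mono mult_left_mono) auto
    also have "\<dots> = (?x + 1 + offset) * (sum \<omega> \<Omega> - ?H)"
      using split by (simp add: sum_distrib_right[symmetric])
    also have "\<dots> \<le> (?x + 1 + offset) * (sum \<omega> \<Omega> - hit_rate * sum \<omega> \<Omega>)"
      using H offset_ge by (intro mult_left_mono) auto
    also have "\<dots> = ((?x + offset + 1) * (1 - hit_rate)) * sum \<omega> \<Omega>" by (simp add: algebra_simps)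
    also have "\<dots> \<le> (decay * (?x + offset)) * sum \<omega> \<Omega>"
    proof (rule mult_right_mono[OF _ M])
      have "0 \<le> hit_rate * ?x" using hit_rate_pos by simp
      then show "(?x + offset + 1) * (1 - hit_rate) \<le> decay * (?x + offset)"
        using offset_hit_rate hit_rate_pos by (simp add: decay_def algebra_simps)
    qed
    finally show ?thesis by simp
  next
    case False
    then have "sorted_list_of_set X \<noteq> []" using finX by auto
    then obtain xs l where xs: "sorted_list_of_set X = xs @ [l]" by (metis rev_exhaust)
    have "distinct (xs @ [l])" "set (xs @ [l]) = X" unfolding xs[symmetric] using finX by auto
    \<comment> \<open>The last vertex \<open>l\<close> is spent on correcting \<open>w\<close>, so
      only \<open>card X - 1\<close> vertices are credited with a chance of being swept
      away.\<close>
    then have xsX: "set xs \<subseteq> X" "card (set xs) = card X - 1" by auto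
    let ?Q = "\<lambda>x E. even (deg_in E (insert w (X \<union> B)) w) \<and> x \<notin> sweep E B X (xs @ [l])"
    let ?c = "1 / (4 * \<rho> ^ 4)"
    have "1 \<le> \<rho> ^ 4" using rho by simp
    then have c: "0 < ?c" "?c \<le> 1" by (auto simp: divide_le_eq)
    \<comment> \<open>If \<open>w\<close> is odd, no \<open>?Q x E\<close> holds and only the
      \<open>+ 1\<close> matters; if \<open>w\<close> is even, each \<open>?Q x E\<close> stands for
      a vertex lost from \<open>X\<close>.\<close>
    have point: "real (card (?A E)) \<le> ?x + 1 - (\<Sum>x\<in>set xs. if ?Q x E then 1 else 0)" for E
    proof (cases "even (deg_in E (insert w (X \<union> B)) w)")
      case True
      let ?S = "sweep E B X (xs @ [l])"
      have "(\<Sum>x\<in>set xs. if ?Q x E then 1 else (0::real)) = real (card {x \<in> set xs. x \<notin> ?S})"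
        using True by (simp add: sum.If_cases Int_def)
      also have "\<dots> \<le> real (card (X - ?S))"
        using finX xsX by (intro of_nat_mono card_mono) auto
      also have "\<dots> = ?x - real (card ?S)"
        using finX sweep_subset[of E B X "xs @ [l]"]
        by (subst card_Diff_subset) (auto intro: finite_subset simp: card_mono of_nat_diff)
      finally show ?thesis using True xs by (simp add: advance_def)
    next
      case False
      then show ?thesis using card_le[of E] by simp
    qed
    have "(\<Sum>E\<in>{E \<in> \<Omega>. ?A E \<noteq> {}}. \<omega> E * (real (card (?A E)) + offset))
        \<le> (\<Sum>E\<in>\<Omega>. \<omega> E * (real (card (?A E)) + offset))"
      using fin\<Omega> w_nonneg offset_ge by (intro sum_mono2) auto
    also have "\<dots> \<le> (\<Sum>E\<in>\<Omega>. \<omega> E *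
        (?x + 1 - (\<Sum>x\<in>set xs. if ?Q x E then 1 else 0) + offset))"
      using w_nonneg point by (intro sum_mono mult_left_mono add_right_mono) auto
    also have "\<dots> = (?x + 1 + offset) * sum \<omega> \<Omega> -
        (\<Sum>E\<in>\<Omega>. \<Sum>x\<in>set xs. if ?Q x E then \<omega> E else 0)"
    proof -
      have "(\<Sum>E\<in>\<Omega>. \<omega> E * (a - g E + c)) = (a + c) * sum \<omega> \<Omega> - (\<Sum>E\<in>\<Omega>. \<omega> E * g E)"
        for a c and g :: "'a set set \<Rightarrow> real"
        unfolding sum_distrib_left sum_subtractf[symmetric]
        by (intro sum.cong) (simp_all add: algebra_simps)
      moreover have "\<omega> E * (\<Sum>x\<in>set xs. if ?Q x E then 1 else 0) =
          (\<Sum>x\<in>set xs. if ?Q x E then \<omega> E else 0)" for E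
        unfolding sum_distrib_left by (intro sum.cong) simp_all
      ultimately show ?thesis by simp
    qed
    also have "(\<Sum>E\<in>\<Omega>. \<Sum>x\<in>set xs. if ?Q x E then \<omega> E else 0) =
        (\<Sum>x\<in>set xs. sum \<omega> {E \<in> \<Omega>. ?Q x E})"
      using fin\<Omega> by (subst sum.swap) (simp add: sum.If_cases Int_def)
    also have "(?x + 1 + offset) * sum \<omega> \<Omega> - \<dots> \<le>
        (?x + 1 + offset) * sum \<omega> \<Omega> - (\<Sum>x\<in>set xs. ?c * sum \<omega> \<Omega>)"
    proof (intro diff_left_mono sum_mono)
      fix x assume "x \<in> set xs"
      then have "sum \<omega> \<Omega> \<le> 4 * \<rho> ^ 4 * sum \<omega> {E \<in> \<Omega>. ?Q x E}"
        using assms xs by (intro advance_drop_mass) auto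
      then show "?c * sum \<omega> \<Omega> \<le> sum \<omega> {E \<in> \<Omega>. ?Q x E}"
        using rho by (simp add: field_simps)
    qed
    also have "\<dots> = (?x + 1 + offset - ?c * (?x - 1)) * sum \<omega> \<Omega>"
      using False xsX by (simp add: of_nat_diff algebra_simps)
    also have "\<dots> \<le> (decay * (?x + offset)) * sum \<omega> \<Omega>"
    proof (rule mult_right_mono[OF _ M])
      \<comment> \<open>Half of \<open>?c * ?x\<close> dominates \<open>hit_rate * ?x / 2\<close>;
        the other half is at least 3 and covers \<open>2 + ?c\<close>.\<close>
      have "24 * \<rho> ^ 4 \<le> ?x" using False small_size_ge by linarith
      then have "6 \<le> ?c * ?x" using rho by (simp add: field_simps)
      moreover have "hit_rate * ?x \<le> ?c * ?x" using hit_rate_le by (intro mult_right_mono) auto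
      moreover have "decay * (?x + offset) = ?x + offset - hit_rate * ?x / 2 - 1"
        using offset_hit_rate by (simp add: decay_def algebra_simps)
      moreover have "?c * (?x - 1) = ?c * ?x - ?c" by (simp only: right_diff_distrib mult_1_right)
      ultimately show "?x + 1 + offset - ?c * (?x - 1) \<le> decay * (?x + offset)"
        using c by linarith
    qed
    finally show ?thesis by simp
  qed
qed

end

section \<open>Iterating the step down the chain\<close>

definition stuck :: "'a set set \<Rightarrow> 'a set \<Rightarrow> bool" where
  "stuck E R \<longleftrightarrow> (\<nexists>Z. card Z = 2 \<and> elim E R Z)"

lemma stuck_elim: "stuck E R \<Longrightarrow> elim E R S \<Longrightarrow> stuck E S"
  unfolding stuck_def using elim_trans by blast

lemma advance_cong:
  assumes "finite X"
    and "even (deg_in E (insert w (X \<union> B)) w) \<longleftrightarrow> even (deg_in E' (insert w (X \<union> B)) w)"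
    and "\<And>x Y. x \<in> X \<Longrightarrow> Y \<subseteq> X \<Longrightarrow>
      even (deg_in E (Y \<union> B) x) \<longleftrightarrow> even (deg_in E' (Y \<union> B) x)"
  shows "advance E B w X = advance E' B w X"
proof -
  have "sweep E B X (sorted_list_of_set X) = sweep E' B X (sorted_list_of_set X)"
    using assms by (intro sweep_cong) auto
  then show ?thesis using assms(2) by (simp add: advance_def)
qed

text \<open>Delete from the largest member down: each then sees exactly \<open>B\<close> and the
  smaller members.\<close>

lemma chain_elim:
  fixes W :: "'a::linorder set"
  assumes "finite W" "W \<inter> B = {}"
    and "\<And>w. w \<in> W \<Longrightarrow> even (deg_in E (B \<union> {v \<in> W. v < w}) w)"
  shows "elim E (B \<union> W) B"
  using assms
proof (induction W rule: finite_linorder_max_induct)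
  case (insert m W)
  have "even (deg_in E (B \<union> {v \<in> W. v < w}) w)" if "w \<in> W" for w
  proof -
    have "{v \<in> insert m W. v < w} = {v \<in> W. v < w}" using insert.hyps that by fastforce
    then show ?thesis using insert.prems(2)[of w] that by simp
  qed
  then have "elim E (B \<union> W) B" using insert by auto
  moreover have "{v \<in> insert m W. v < m} = W" using insert.hyps by auto
  then have "even (deg_in E (B \<union> W) m)" using insert.prems(2)[of m] by simp
  then have "even (deg_in E (B \<union> insert m W) m)" by (simp add: deg_in_def)
  then have "elim E (B \<union> insert m W) (B \<union> insert m W - {m})" by (intro elim_one) auto
  moreover have "B \<union> insert m W - {m} = B \<union> W" using insert by auto
  ultimately show ?case using elim_trans by metis
qed auto

context flip_weight
begin

text \<open>Induction from the top of the chain. The family is split by the outcome \<open>Y\<close>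
  of a step; each part meets the hypotheses again with \<open>Y\<close> for \<open>X\<close>, and
  \<open>advance_potential\<close> averages over the parts. \<open>X\<close> is drawn from
  \<open>D\<close>. Arms from larger to smaller chain members are needed because an odd member joins
  \<open>X\<close>.\<close>

lemma stuck_chain_mass:
  assumes "finite W" and z: "z \<in> B" and B: "card B = 2" "B \<subseteq> V"
  shows "\<lbrakk>\<Omega> \<subseteq> Pow (vertex_pairs V); X \<subseteq> D; D \<subseteq> V; W \<subseteq> V; W \<inter> B = {}; D \<inter> (B \<union> W) = {};
    \<And>E w. E \<in> \<Omega> \<Longrightarrow> w \<in> W \<Longrightarrow> even (deg_in E (B \<union> {v \<in> W. v < w}) w);
    \<And>E. E \<in> \<Omega> \<Longrightarrow> even (edges_in E (X \<union> (B \<union> W))) \<longleftrightarrow> even (edges_in E B);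
    \<And>E x w. E \<in> \<Omega> \<Longrightarrow> w \<in> W \<Longrightarrow> x \<in> D \<or> x \<in> W \<and> w < x \<Longrightarrow> toggle E (arm z x w) \<in> \<Omega>\<rbrakk>
    \<Longrightarrow> sum \<omega> {E \<in> \<Omega>. stuck E (X \<union> (B \<union> W))} \<le> decay ^ card W * (real (card X) + offset) * sum \<omega> \<Omega>"
  using \<open>finite W\<close>
proof (induction W arbitrary: \<Omega> X D rule: finite_linorder_max_induct)
  case empty
  have "sum \<omega> {E \<in> \<Omega>. stuck E (X \<union> (B \<union> {}))} \<le> sum \<omega> \<Omega>"
    using empty by (intro mass_mono) auto
  also have "sum \<omega> \<Omega> \<le> (real (card X) + offset) * sum \<omega> \<Omega>"
    using mult_right_mono[of 1 "real (card X) + offset" "sum \<omega> \<Omega>"] mass_nonneg[of \<Omega>] empty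
      offset_ge by simp
  finally show ?case by simp
next
  case (insert w W)
  note \<Omega> = insert.prems(1)
  let ?B = "B \<union> W"
  let ?A = "\<lambda>E. advance E ?B w X"
  have fin: "finite X" "finite B" "finite D" "finite \<Omega>"
    using finite_subset[OF _ finite_V] insert.prems(2,3) B finite_graphs[OF \<Omega>] by auto
  have below: "{v \<in> insert w W. v < u} = {v \<in> W. v < u}"
    if "u \<in> W" for u using insert.hyps that by fastforce
  have wfacts: "w \<notin> W" "w \<notin> B" "w \<notin> X" "w \<notin> D" "w \<in> V" "w \<noteq> z"
    using insert.hyps insert.prems z by auto
  have XB: "X \<inter> ?B = {}" using insert.prems by auto
  have bel: "{v \<in> insert w W. v < w} = W" using insert.hyps by auto
  have chain_w: "even (deg_in E ?B w)" if "E \<in> \<Omega>" for E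
    using insert.prems(7)[OF that, of w] bel by simp
  have chain_W: "even (deg_in E (B \<union> {v \<in> W. v < u}) u)" if "E \<in> \<Omega>" "u \<in> W" for E u
    using insert.prems(7)[OF that(1), of u] that(2) below[of u] by simp
  have edges_W: "even (edges_in E ?B) \<longleftrightarrow> even (edges_in E B)" if "E \<in> \<Omega>" for E
    using chain_elim[of W B E] chain_W[OF that] insert fin by (intro elim_parity) auto
  have set_eq: "X \<union> (B \<union> insert w W) = insert w (X \<union> ?B)" by auto
  have par: "even (edges_in E (insert w (X \<union> ?B))) \<longleftrightarrow> even (edges_in E ?B)" if "E \<in> \<Omega>" for E
    using insert.prems(8)[OF that] edges_W[OF that] set_eq by simp
  have elim_A: "elim E (insert w (X \<union> ?B)) (?A E \<union> ?B)" for E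
    using fin XB wfacts by (intro advance_elim) auto
  have stuck_A: "stuck E (?A E \<union> ?B)" if "stuck E (X \<union> (B \<union> insert w W))" for E
    using stuck_elim[OF that[unfolded set_eq] elim_A] .
  \<comment> \<open>Once \<open>X\<close> is empty, the rest of the chain collapses onto the two
    vertices of \<open>B\<close>; so stuck graphs occur only among the nonempty outcomes.\<close>
  have not_hit: "?A E \<noteq> {}" if "E \<in> \<Omega>" "stuck E (X \<union> (B \<union> insert w W))" for E
  proof
    assume "?A E = {}"
    then have "stuck E ?B" using stuck_A[OF that(2)] by simp
    moreover have "elim E ?B B"
      using chain_elim[of W B E] chain_W[OF that(1)] insert by auto
    ultimately show False using B stuck_def by blast
  qed
  \<comment> \<open>Randomness for later steps is untouched: \<open>u\<close> and \<open>z\<close>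
    both stay present throughout this step, so the edges of the arm cancel at \<open>x\<close>, and
    no other vertex examined meets the arm.\<close>
  have same: "?A (toggle E (arm z x u)) = ?A E"
    if "u \<in> W" "x \<in> insert w D \<or> x \<in> W \<and> u < x" for E x u
  proof -
    have xu: "x \<noteq> u" "x \<noteq> z" "u \<noteq> z" "u \<noteq> w" "u \<notin> X" "z \<notin> X" "z \<noteq> w"
      using that insert.prems insert.hyps z wfacts by auto
    have "x \<notin> B" using that insert.prems wfacts by auto
    then show ?thesis
    proof (intro advance_cong)
      show "even (deg_in (toggle E (arm z x u)) (insert w (X \<union> ?B)) w) \<longleftrightarrow>
          even (deg_in E (insert w (X \<union> ?B)) w)"
        using xu fin insert.hyps z that by (intro deg_in_arm_same) auto
      fix y Y assume "y \<in> X" "Y \<subseteq> X"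
      then show "even (deg_in (toggle E (arm z x u)) (Y \<union> ?B) y) \<longleftrightarrow>
          even (deg_in E (Y \<union> ?B) y)"
        using xu fin insert.hyps z that by (intro deg_in_arm_same) (auto intro: finite_subset)
    qed (use fin in auto)
  qed
  let ?AS = "?A ` {E \<in> \<Omega>. ?A E \<noteq> {}}"
  have finAS: "finite ?AS" using fin by auto
  have part: "sum \<omega> {E \<in> \<Omega>. ?A E = Y \<and> stuck E (Y \<union> ?B)} \<le>
      decay ^ card W * (real (card Y) + offset) * sum \<omega> {E \<in> \<Omega>. ?A E = Y}"
    if "Y \<in> ?AS" for Y
  proof -
    have Y: "Y \<subseteq> insert w X" using that advance_subset[of _ ?B w X] by blast
    have "sum \<omega> {E \<in> {E \<in> \<Omega>. ?A E = Y}. stuck E (Y \<union> (B \<union> W))} \<le>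
      decay ^ card W * (real (card Y) + offset) * sum \<omega> {E \<in> \<Omega>. ?A E = Y}"
    proof (rule insert.IH[where D = "insert w D"])
      show "even (edges_in E (Y \<union> (B \<union> W))) \<longleftrightarrow> even (edges_in E B)"
        if "E \<in> {E \<in> \<Omega>. ?A E = Y}" for E
        using elim_parity[OF elim_A[of E]] that par[of E] edges_W[of E] fin insert.hyps by auto
      show "toggle E (arm z x u) \<in> {E \<in> \<Omega>. ?A E = Y}"
        if "E \<in> {E \<in> \<Omega>. ?A E = Y}" "u \<in> W" "x \<in> insert w D \<or> x \<in> W \<and> u < x" for E x u
        using that same[OF that(2,3)] insert.prems(9)[of E u x] insert.hyps by auto
      show "even (deg_in E (B \<union> {v \<in> W. v < u}) u)"
        if "E \<in> {E \<in> \<Omega>. ?A E = Y}" "u \<in> W" for E u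
        using that chain_W by blast
    qed (use Y insert.prems insert.hyps wfacts in auto)
    moreover have "{E \<in> {E \<in> \<Omega>. ?A E = Y}. stuck E (Y \<union> (B \<union> W))} =
      {E \<in> \<Omega>. ?A E = Y \<and> stuck E (Y \<union> ?B)}" by auto
    ultimately show ?thesis by simp
  qed
  have "sum \<omega> {E \<in> \<Omega>. stuck E (X \<union> (B \<union> insert w W))} \<le>
      sum \<omega> (\<Union>Y\<in>?AS. {E \<in> \<Omega>. ?A E = Y \<and> stuck E (Y \<union> ?B)})"
  proof (rule mass_mono)
    show "{E \<in> \<Omega>. stuck E (X \<union> (B \<union> insert w W))} \<subseteq>
        (\<Union>Y\<in>?AS. {E \<in> \<Omega>. ?A E = Y \<and> stuck E (Y \<union> ?B)})"
    proof
      fix E assume "E \<in> {E \<in> \<Omega>. stuck E (X \<union> (B \<union> insert w W))}"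
      then have "E \<in> \<Omega>" "?A E \<noteq> {}" "stuck E (?A E \<union> ?B)"
        using not_hit stuck_A by auto
      then show "E \<in> (\<Union>Y\<in>?AS. {E \<in> \<Omega>. ?A E = Y \<and> stuck E (Y \<union> ?B)})"
        by (intro UN_I[of "?A E"]) auto
    qed
  qed (use \<Omega> in auto)
  also have "\<dots> = (\<Sum>Y\<in>?AS. sum \<omega> {E \<in> \<Omega>. ?A E = Y \<and> stuck E (Y \<union> ?B)})"
    using finAS fin by (intro sum.UNION_disjoint) auto
  also have "\<dots> \<le> (\<Sum>Y\<in>?AS. decay ^ card W * (real (card Y) + offset) * sum \<omega> {E \<in> \<Omega>. ?A E = Y})"
    by (intro sum_mono part)
  also have "\<dots> = decay ^ card W * (\<Sum>Y\<in>?AS. \<Sum>E\<in>{E \<in> \<Omega>. ?A E = Y}. \<omega> E * (real (card (?A E)) + offset))"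
    by (simp add: sum_distrib_left mult.assoc mult.left_commute mult.commute)
  also have "(\<Sum>Y\<in>?AS. \<Sum>E\<in>{E \<in> \<Omega>. ?A E = Y}. \<omega> E * (real (card (?A E)) + offset)) =
      (\<Sum>E\<in>{E \<in> \<Omega>. ?A E \<noteq> {}}. \<omega> E * (real (card (?A E)) + offset))"
  proof -
    have "(\<Sum>Y\<in>?AS. \<Sum>E\<in>{E \<in> \<Omega>. ?A E = Y}. \<omega> E * (real (card (?A E)) + offset)) =
      (\<Sum>Y\<in>?AS. \<Sum>E\<in>{E \<in> {E \<in> \<Omega>. ?A E \<noteq> {}}. ?A E = Y}. \<omega> E * (real (card (?A E)) + offset))"
      by (intro sum.cong) auto
    also have "\<dots> = (\<Sum>E\<in>{E \<in> \<Omega>. ?A E \<noteq> {}}. \<omega> E * (real (card (?A E)) + offset))"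
      using fin by (intro sum.group) auto
    finally show ?thesis .
  qed
  also have "decay ^ card W * \<dots> \<le> decay ^ card W * (decay * (real (card X) + offset) * sum \<omega> \<Omega>)"
  proof (intro mult_left_mono advance_potential)
    show "toggle E (arm z x w) \<in> \<Omega>" if "E \<in> \<Omega>" "x \<in> X" for E x
      using insert.prems(2) insert.prems(9)[of E w x] that by auto
  qed (use \<Omega> insert.prems B wfacts z XB par decay_bounds in auto)
  also have "\<dots> = decay ^ card (insert w W) * (real (card X) + offset) * sum \<omega> \<Omega>"
    using insert.hyps wfacts by (simp add: mult.assoc)
  finally show ?case .
qed

end

section \<open>Rejected vertices\<close>

lemma deg_in_edge_same:
  assumes "finite R" "v \<noteq> x" "v \<noteq> y"
  shows "even (deg_in (toggle E {{x, y}}) R v) \<longleftrightarrow> even (deg_in E R v)"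
proof -
  have *: "{w \<in> R - {v}. {v, w} \<in> {{x, y}}} = {}"
    using assms by (auto simp: doubleton_eq_iff)
  show ?thesis unfolding even_deg_in_toggle[OF assms(1)] * by simp
qed

lemma deg_in_edge_flip:
  assumes "finite R" "x \<noteq> y" "y \<in> R"
  shows "even (deg_in (toggle E {{x, y}}) R x) \<longleftrightarrow> odd (deg_in E R x)"
proof -
  have *: "{w \<in> R - {x}. {x, w} \<in> {{x, y}}} = {y}"
    using assms by (auto simp: doubleton_eq_iff)
  show ?thesis unfolding even_deg_in_toggle[OF assms(1)] * by simp
qed

lemma deg_in_remove:
  assumes "finite R" "u \<in> R" "u \<noteq> y" "{y, u} \<in> E"
  shows "deg_in E R y = Suc (deg_in E (R - {u}) y)"
proof -
  have "{w \<in> R - {y}. {y, w} \<in> E} = insert u {w \<in> R - {u} - {y}. {y, w} \<in> E}"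
    using assms by auto
  then show ?thesis using assms(1) by (simp add: deg_in_def)
qed

lemma even_edges_in_toggle:
  assumes "finite R"
  shows "even (edges_in (toggle E T) R) \<longleftrightarrow>
    (even (edges_in E R) \<longleftrightarrow> even (card {e \<in> vertex_pairs R. e \<in> T}))"
  unfolding edges_in_def using even_card_toggle[OF finite_vertex_pairs[OF assms], of "\<lambda>e. e" E T] .

lemma edges_in_arm_same:
  assumes "finite R" "x \<noteq> w" "x \<noteq> z" "w \<noteq> z" "x \<notin> R \<or> w \<in> R \<and> z \<in> R"
  shows "even (edges_in (toggle E (arm z x w)) R) \<longleftrightarrow> even (edges_in E R)"
proof -
  have "{e \<in> vertex_pairs R. e \<in> arm z x w} = (if x \<in> R then {{x, w}, {x, z}} else {})"
    using assms(2-) by (auto simp: arm_def vertex_pairs_def)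
  moreover have "card {{x, w}, {x, z}} = 2"
    using assms by (simp add: doubleton_eq_iff)
  ultimately show ?thesis using assms(1) by (auto simp: even_edges_in_toggle)
qed

definition helps :: "'a set set \<Rightarrow> 'a set \<Rightarrow> 'a \<Rightarrow> 'a \<Rightarrow> bool" where
  "helps E R y u \<longleftrightarrow> {u, y} \<in> E \<and> even (deg_in E R u)"

context flip_weight
begin

text \<open>A fresh vertex helps with probability at least \<open>1 / (4 * \<rho>\<^sup>2)\<close>:
  four toggles, of at most two edges, suffice to make it help.\<close>

definition miss :: real where
  "miss = 1 - 1 / (4 * \<rho>\<^sup>2)"

lemma miss_bounds: "0 \<le> miss" "miss < 1"
proof -
  have "1 \<le> \<rho>\<^sup>2" using rho by simp
  then show "0 \<le> miss" "miss < 1" by (auto simp: miss_def divide_le_eq)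
qed

text \<open>For one \<open>u\<close> at a time, \<open>{u, y}\<close> creates the adjacency and then
  \<open>{u, z}\<close> corrects the parity. Neither edge affects whether another member of
  \<open>S\<close> helps, so the factors multiply.\<close>

lemma no_helper_mass:
  assumes "finite S" and \<Omega>: "\<Omega> \<subseteq> Pow (vertex_pairs V)" and R: "R \<subseteq> V" "z \<in> R" "y \<in> R" "y \<noteq> z"
    and S: "S \<subseteq> R" "y \<notin> S" "z \<notin> S"
    and closed: "\<And>E u. E \<in> \<Omega> \<Longrightarrow> u \<in> S \<Longrightarrow> toggle E {{u, z}} \<in> \<Omega> \<and> toggle E {{u, y}} \<in> \<Omega>"
  shows "sum \<omega> {E \<in> \<Omega>. \<forall>u\<in>S. \<not> helps E R y u} \<le> miss ^ card S * sum \<omega> \<Omega>"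
  using assms(1) S closed
proof (induction S)
  case (insert u S)
  let ?\<Omega> = "{E \<in> \<Omega>. \<forall>u\<in>S. \<not> helps E R y u}"
  have fin: "finite R" "finite ?\<Omega>" using R finite_V finite_subset finite_graphs[OF \<Omega>] by auto
  have \<Omega>': "?\<Omega> \<subseteq> Pow (vertex_pairs V)" using \<Omega> by auto
  have u: "u \<in> R" "u \<noteq> y" "u \<noteq> z" using insert.prems by auto
  have other: "helps (toggle E {{u, z}}) R y v \<longleftrightarrow> helps E R y v"
    "helps (toggle E {{u, y}}) R y v \<longleftrightarrow> helps E R y v" if "v \<in> S" for E v
  proof -
    have "v \<noteq> u" "v \<noteq> z" "v \<noteq> y" using that insert by auto
    then show "helps (toggle E {{u, z}}) R y v \<longleftrightarrow> helps E R y v"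
      "helps (toggle E {{u, y}}) R y v \<longleftrightarrow> helps E R y v"
      using fin R by (auto simp: helps_def deg_in_edge_same doubleton_eq_iff)
  qed
  have cl: "toggle E {{u, z}} \<in> ?\<Omega>" "toggle E {{u, y}} \<in> ?\<Omega>" if "E \<in> ?\<Omega>" for E
    using that insert.prems(4)[of E u] other by auto
  let ?F = "{{}, {{u, z}}, {{u, y}}, {{u, y}, {u, z}}}"
  have ne: "{u, y} \<noteq> {u, z}" using R by (auto simp: doubleton_eq_iff)
  have "sum \<omega> ?\<Omega> \<le> real (card ?F) * \<rho> ^ 2 * sum \<omega> {E \<in> ?\<Omega>. helps E R y u}"
  proof (rule mass_le_reachable[OF \<Omega>'])
    fix T assume "T \<in> ?F"
    moreover have "card {{u, y}, {u, z}} \<le> 2" by (simp add: card_insert_if)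
    ultimately show "T \<subseteq> vertex_pairs V \<and> card T \<le> 2"
      using u R insert.prems by (auto simp: vertex_pairs_def)
  next
    fix E assume E: "E \<in> ?\<Omega>"
    define T where "T = (if {u, y} \<in> E then {} else {{u, y}})"
    define T' where "T' = (if even (deg_in (toggle E T) R u) then {} else {{u, z}})"
    let ?E = "toggle (toggle E T) T'"
    have T: "toggle E T \<in> ?\<Omega>" "{u, y} \<in> toggle E T" using E cl(2) by (auto simp: T_def)
    have "?E \<in> ?\<Omega>" using T cl(1) by (auto simp: T'_def)
    moreover have "{u, y} \<in> ?E" using T ne by (auto simp: T'_def)
    moreover have "even (deg_in ?E R u)"
      using fin u R by (auto simp: T'_def deg_in_edge_flip)
    ultimately have "?E \<in> ?\<Omega> \<and> helps ?E R y u" by (simp only: helps_def simp_thms)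
    moreover have "?E = toggle E (T \<union> T')"
      using ne by (intro toggle_Un) (auto simp: T_def T'_def)
    moreover have "T \<union> T' \<in> ?F" by (auto simp: T_def T'_def)
    ultimately show "\<exists>T\<in>?F. toggle E T \<in> ?\<Omega> \<and> helps (toggle E T) R y u"
      by (intro bexI[of _ "T \<union> T'"]) (simp_all only:)
  qed simp
  also have "\<dots> \<le> 4 * \<rho>\<^sup>2 * sum \<omega> {E \<in> ?\<Omega>. helps E R y u}"
  proof (intro mult_right_mono)
    have "card ?F \<le> 4" by (simp add: card_insert_if)
    then show "real (card ?F) \<le> 4" by simp
  qed (use \<Omega> in \<open>auto intro!: mass_nonneg\<close>)
  finally have good: "1 / (4 * \<rho>\<^sup>2) * sum \<omega> ?\<Omega> \<le> sum \<omega> {E \<in> ?\<Omega>. helps E R y u}"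
    using rho by (simp add: pos_divide_le_eq mult.commute)
  have "sum \<omega> ?\<Omega> = sum \<omega> {E \<in> ?\<Omega>. helps E R y u} + sum \<omega> {E \<in> \<Omega>. \<forall>u\<in>insert u S. \<not> helps E R y u}"
    using fin finite_graphs[OF \<Omega>] by (subst sum.union_disjoint[symmetric]) (auto intro: sum.cong)
  with good have "sum \<omega> {E \<in> \<Omega>. \<forall>u\<in>insert u S. \<not> helps E R y u} \<le> miss * sum \<omega> ?\<Omega>"
    by (simp add: miss_def left_diff_distrib)
  also have "\<dots> \<le> miss * (miss ^ card S * sum \<omega> \<Omega>)"
    using insert miss_bounds by (intro mult_left_mono insert.IH) auto
  finally show ?case using insert.hyps by (simp add: mult.assoc)
qed simp

text \<open>
  An odd vertex \<open>y\<close> becomes even once an even neighbour of it has been removed; a batch of fresh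
  vertices contains such a neighbour except with exponentially small probability.
\<close>

lemma stuck_rejects_mass:
  assumes z: "z \<in> B" and B: "card B = 2" "B \<subseteq> V" and W: "W \<subseteq> V" "W \<inter> B = {}"
    and D: "D \<subseteq> V" "D \<inter> (B \<union> W) = {}"
  shows "\<lbrakk>\<Omega> \<subseteq> Pow (vertex_pairs V); X \<subseteq> D; distinct ys; set ys \<subseteq> V; set ys \<inter> (B \<union> W \<union> D) = {};
    \<And>y. y \<in> set ys \<Longrightarrow> bt y \<subseteq> X \<and> card (bt y) = t;
    \<And>y y'. \<lbrakk>y \<in> set ys; y' \<in> set ys; y \<noteq> y'\<rbrakk> \<Longrightarrow> bt y \<inter> bt y' = {};
    \<And>E w. E \<in> \<Omega> \<Longrightarrow> w \<in> W \<Longrightarrow> even (deg_in E (B \<union> {v \<in> W. v < w}) w);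
    \<And>E x w. E \<in> \<Omega> \<Longrightarrow> w \<in> W \<Longrightarrow> x \<in> D \<or> x \<in> W \<and> w < x \<Longrightarrow> toggle E (arm z x w) \<in> \<Omega>;
    \<And>E y u. \<lbrakk>E \<in> \<Omega>; y \<in> set ys; u \<in> bt y\<rbrakk> \<Longrightarrow> toggle E {{u, z}} \<in> \<Omega> \<and> toggle E {{u, y}} \<in> \<Omega>\<rbrakk>
    \<Longrightarrow> sum \<omega> {E \<in> \<Omega>. (even (edges_in E (X \<union> set ys \<union> (B \<union> W))) \<longleftrightarrow> even (edges_in E B)) \<and>
        stuck E (X \<union> set ys \<union> (B \<union> W))}
      \<le> (real (length ys) * miss ^ t + decay ^ card W * (real (card D) + offset)) * sum \<omega> \<Omega>"
proof (induction ys arbitrary: \<Omega> X)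
  case Nil
  note \<Omega> = Nil.prems(1)
  let ?par = "\<lambda>E. even (edges_in E (X \<union> (B \<union> W))) \<longleftrightarrow> even (edges_in E B)"
  \<comment> \<open>The edge parity is made part of the family only now: arms preserve it, whereas
    the single edges toggled at batch vertices may not.\<close>
  let ?\<Omega> = "{E \<in> \<Omega>. ?par E}"
  have fin: "finite X" "finite B" "finite W" "finite D"
    using finite_subset[OF _ finite_V] Nil.prems(2) B W D by auto
  have "sum \<omega> {E \<in> ?\<Omega>. stuck E (X \<union> (B \<union> W))} \<le> decay ^ card W * (real (card X) + offset) * sum \<omega> ?\<Omega>"
  proof (rule stuck_chain_mass[OF fin(3) z B])
    show "toggle E (arm z x w) \<in> ?\<Omega>" if "E \<in> ?\<Omega>" "w \<in> W" "x \<in> D \<or> x \<in> W \<and> w < x" for E x w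
    proof -
      have "x \<noteq> w" "x \<noteq> z" "w \<noteq> z" "x \<notin> B" using that(2,3) z W D by auto
      then show ?thesis using that Nil.prems(9) fin z by (auto simp: edges_in_arm_same)
    qed
  qed (use Nil.prems W D in auto)
  also have "\<dots> \<le> decay ^ card W * (real (card D) + offset) * sum \<omega> \<Omega>"
    using \<Omega> Nil.prems(2) fin decay_bounds offset_ge
    by (intro mult_mono mass_mono mass_nonneg mult_nonneg_nonneg) (auto intro: card_mono)
  finally show ?case by (simp add: conj_assoc)
next
  case (Cons y ys)
  note \<Omega> = Cons.prems(1)
  let ?K = "B \<union> W"
  let ?R = "X \<union> set (y # ys) \<union> ?K"
  let ?par = "\<lambda>E R. even (edges_in E R) \<longleftrightarrow> even (edges_in E B)"
  let ?bad = "\<lambda>E. \<forall>u\<in>bt y. \<not> helps E ?R y u"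
  \<comment> \<open>What remains of \<open>X\<close> once \<open>y\<close> is gone. The choice by
    \<open>SOME\<close> is meaningful only outside \<open>?bad\<close>, where removing the chosen
    helper makes \<open>y\<close> even.\<close>
  define nx where "nx E = (if even (deg_in E ?R y) then X
    else X - {SOME u. u \<in> bt y \<and> helps E ?R y u})" for E
  have RV: "?R \<subseteq> V" using Cons.prems(2,4) B W D by auto
  have fin: "finite X" "finite B" "finite W" "finite D" "finite ?R" "finite \<Omega>"
    using finite_subset[OF _ finite_V] Cons.prems(2) B W D RV finite_graphs[OF \<Omega>] by blast+
  have bt: "bt y \<subseteq> X" "card (bt y) = t" "y \<notin> bt y" "z \<notin> bt y" "y \<noteq> z" "y \<notin> X"
    using Cons.prems(2,5) Cons.prems(6)[of y] z D by auto
  have finbt: "finite (bt y)" using bt fin finite_subset by blast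
  have pick: "(SOME u. u \<in> bt y \<and> helps E ?R y u) \<in> bt y"
    "helps E ?R y (SOME u. u \<in> bt y \<and> helps E ?R y u)" if "\<not> ?bad E" for E
    using that someI_ex[of "\<lambda>u. u \<in> bt y \<and> helps E ?R y u"] by auto
  have nx_elim: "elim E ?R (nx E \<union> set ys \<union> ?K)" if "\<not> ?bad E" for E
  proof (cases "even (deg_in E ?R y)")
    case True
    have "?R - {y} = X \<union> set ys \<union> ?K" using Cons.prems bt by auto
    then show ?thesis using elim_one[OF _ True] True by (simp add: nx_def)
  next
    case False
    define u where "u = (SOME u. u \<in> bt y \<and> helps E ?R y u)"
    have u: "u \<in> bt y" "helps E ?R y u" unfolding u_def using pick[OF that] by auto
    have uR: "u \<in> ?R" "u \<noteq> y" using u bt by auto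
    have "elim E ?R (?R - {u})" using u uR by (intro elim_one) (auto simp: helps_def)
    moreover have "even (deg_in E (?R - {u}) y)"
      using deg_in_remove[OF fin(5) uR, of E] False u by (auto simp: helps_def insert_commute)
    then have "elim E (?R - {u}) (?R - {u} - {y})" using uR by (intro elim_one) auto
    moreover have "nx E = X - {u}" unfolding nx_def u_def using False by (simp only: if_False)
    then have "?R - {u} - {y} = nx E \<union> set ys \<union> ?K"
      using Cons.prems(2,3,5) bt(1,6) u(1) D(2) by auto
    ultimately show ?thesis using elim_trans by metis
  qed
  \<comment> \<open>The outcome depends on the graph only through these parities and adjacencies, so
    toggles that keep them preserve each class \<open>nx E = Y\<close>.\<close>
  have nx_cong: "(?bad E \<longleftrightarrow> ?bad E') \<and> nx E = nx E'"
    if "even (deg_in E ?R y) \<longleftrightarrow> even (deg_in E' ?R y)"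
      "\<And>u. u \<in> bt y \<Longrightarrow> even (deg_in E ?R u) \<longleftrightarrow> even (deg_in E' ?R u)"
      "\<And>u. u \<in> bt y \<Longrightarrow> {u, y} \<in> E \<longleftrightarrow> {u, y} \<in> E'" for E E'
  proof -
    have "(u \<in> bt y \<and> helps E ?R y u) = (u \<in> bt y \<and> helps E' ?R y u)" for u
      using that(2,3)[of u] by (auto simp: helps_def)
    then show ?thesis using that(1) unfolding nx_def by (auto cong: conj_cong)
  qed
  let ?G = "{E \<in> \<Omega>. \<not> ?bad E}"
  have arm_same: "(?bad (toggle E (arm z x w)) \<longleftrightarrow> ?bad E) \<and> nx (toggle E (arm z x w)) = nx E"
    if "w \<in> W" "x \<in> D \<or> x \<in> W \<and> w < x" for E x w
  proof -
    have *: "x \<noteq> w" "x \<noteq> z" "w \<noteq> z" "y \<noteq> x" "y \<noteq> w" "w \<in> ?R" "z \<in> ?R" "w \<notin> bt y"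
      using that z W D Cons.prems(2,5) bt by auto
    show ?thesis
      using * fin bt by (intro nx_cong deg_in_arm_same) (auto simp: arm_def doubleton_eq_iff)
  qed
  have edge_same: "(?bad (toggle E {{u, v}}) \<longleftrightarrow> ?bad E) \<and> nx (toggle E {{u, v}}) = nx E"
    if "y' \<in> set ys" "u \<in> bt y'" "v = z \<or> v = y'" for E y' u v
  proof -
    have "bt y \<inter> bt y' = {}" "y' \<noteq> y" "bt y' \<subseteq> X" "y' \<notin> bt y"
      using Cons.prems(2,3,5) Cons.prems(6)[of y'] Cons.prems(7)[of y y'] that bt by auto
    then have *: "u \<notin> bt y" "u \<noteq> y" "v \<noteq> y" "v \<notin> bt y" using that bt by auto
    show ?thesis using * fin by (intro nx_cong deg_in_edge_same) (auto simp: doubleton_eq_iff)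
  qed
  let ?rate = "real (length ys) * miss ^ t + decay ^ card W * (real (card D) + offset)"
  let ?NX = "nx ` ?G"
  have part: "sum \<omega> {E \<in> {E \<in> ?G. nx E = Y}. ?par E (Y \<union> set ys \<union> ?K) \<and> stuck E (Y \<union> set ys \<union> ?K)}
      \<le> ?rate * sum \<omega> {E \<in> ?G. nx E = Y}" if "Y \<in> ?NX" for Y
  proof -
    \<comment> \<open>At most one vertex, from the batch of \<open>y\<close>, has been used up; by
      disjointness the other batches lie intact in \<open>Y\<close>.\<close>
    have Y: "Y \<subseteq> X" "X - bt y \<subseteq> Y"
      using that pick by (auto simp: nx_def split: if_splits)
    show ?thesis
    proof (rule Cons.IH)
      show "bt y' \<subseteq> Y \<and> card (bt y') = t" if "y' \<in> set ys" for y'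
        using Cons.prems(3) Cons.prems(6)[of y'] Cons.prems(7)[of y' y] that Y by auto
      show "toggle E (arm z x w) \<in> {E \<in> ?G. nx E = Y}"
        if "E \<in> {E \<in> ?G. nx E = Y}" "w \<in> W" "x \<in> D \<or> x \<in> W \<and> w < x" for E x w
        using that(1) Cons.prems(9)[OF _ that(2,3), of E] arm_same[OF that(2,3), of E]
        by (simp only: mem_Collect_eq simp_thms)
      show "toggle E {{u, z}} \<in> {E \<in> ?G. nx E = Y} \<and> toggle E {{u, y'}} \<in> {E \<in> ?G. nx E = Y}"
        if "E \<in> {E \<in> ?G. nx E = Y}" "y' \<in> set ys" "u \<in> bt y'" for E y' u
        using that(1) Cons.prems(10)[OF _ list.set_intros(2)[OF that(2)] that(3), of E]
          edge_same[OF that(2,3), of z E] edge_same[OF that(2,3), of y' E]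
        by (simp only: mem_Collect_eq simp_thms)
      show "even (deg_in E (B \<union> {v \<in> W. v < w}) w)"
        if "E \<in> {E \<in> ?G. nx E = Y}" "w \<in> W" for E w
        using that Cons.prems(8) by blast
      show "bt y1 \<inter> bt y2 = {}" if "y1 \<in> set ys" "y2 \<in> set ys" "y1 \<noteq> y2" for y1 y2
        using that Cons.prems(7) by simp
      show "{E \<in> ?G. nx E = Y} \<subseteq> Pow (vertex_pairs V)" using \<Omega> by blast
      show "Y \<subseteq> D" using Y Cons.prems(2) by blast
    qed (use Cons.prems(3-5) in simp_all)
  qed
  have split: "sum \<omega> {E \<in> \<Omega>. ?par E ?R \<and> stuck E ?R} \<le> sum \<omega> ({E \<in> \<Omega>. ?bad E} \<union>
      (\<Union>Y\<in>?NX. {E \<in> {E \<in> ?G. nx E = Y}. ?par E (Y \<union> set ys \<union> ?K) \<and> stuck E (Y \<union> set ys \<union> ?K)}))"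
  proof (rule mass_mono)
    show "{E \<in> \<Omega>. ?par E ?R \<and> stuck E ?R} \<subseteq> {E \<in> \<Omega>. ?bad E} \<union>
      (\<Union>Y\<in>?NX. {E \<in> {E \<in> ?G. nx E = Y}. ?par E (Y \<union> set ys \<union> ?K) \<and> stuck E (Y \<union> set ys \<union> ?K)})"
    proof
      fix E assume E: "E \<in> {E \<in> \<Omega>. ?par E ?R \<and> stuck E ?R}"
      show "E \<in> {E \<in> \<Omega>. ?bad E} \<union>
        (\<Union>Y\<in>?NX. {E \<in> {E \<in> ?G. nx E = Y}. ?par E (Y \<union> set ys \<union> ?K) \<and> stuck E (Y \<union> set ys \<union> ?K)})"
      proof (cases "?bad E")
        case False
        from E have E': "E \<in> \<Omega>" "?par E ?R" "stuck E ?R" by blast+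
        have "stuck E (nx E \<union> set ys \<union> ?K)" by (rule stuck_elim[OF E'(3) nx_elim[OF False]])
        moreover have "?par E (nx E \<union> set ys \<union> ?K)"
          using elim_parity[OF nx_elim[OF False] fin(5)] E'(2) by (simp only:)
        moreover have "E \<in> {E \<in> ?G. nx E = nx E}" "nx E \<in> ?NX" using E'(1) False by blast+
        ultimately show ?thesis by (intro UnI2 UN_I[of "nx E"]) simp_all
      qed (use E in auto)
    qed
  qed (use \<Omega> in blast)
  have chain: "\<lbrakk>a1 \<le> a2 + a3; a3 \<le> a4; a4 = r * a5; a5 = a6; a2 \<le> a7; r * a6 \<le> a8\<rbrakk> \<Longrightarrow> a1 \<le> a7 + a8"
    for a1 a2 a3 a4 a5 a6 a7 a8 r :: real
    by (metis add_mono order.trans)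
  have "sum \<omega> ({E \<in> \<Omega>. ?bad E} \<union> (\<Union>Y\<in>?NX. {E \<in> {E \<in> ?G. nx E = Y}. ?par E (Y \<union> set ys \<union> ?K) \<and> stuck E (Y \<union> set ys \<union> ?K)})) = sum \<omega> {E \<in> \<Omega>. ?bad E} +
    sum \<omega> (\<Union>Y\<in>?NX. {E \<in> {E \<in> ?G. nx E = Y}. ?par E (Y \<union> set ys \<union> ?K) \<and> stuck E (Y \<union> set ys \<union> ?K)})"
    using fin by (intro sum.union_disjoint) auto
  also have "sum \<omega> (\<Union>Y\<in>?NX. {E \<in> {E \<in> ?G. nx E = Y}. ?par E (Y \<union> set ys \<union> ?K) \<and> stuck E (Y \<union> set ys \<union> ?K)})
    = (\<Sum>Y\<in>?NX. sum \<omega> {E \<in> {E \<in> ?G. nx E = Y}. ?par E (Y \<union> set ys \<union> ?K) \<and> stuck E (Y \<union> set ys \<union> ?K)})"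
    using fin by (intro sum.UNION_disjoint) auto
  finally have "sum \<omega> {E \<in> \<Omega>. ?par E ?R \<and> stuck E ?R} \<le> sum \<omega> {E \<in> \<Omega>. ?bad E} + \<dots>"
    using split by (simp only:)
  moreover have "(\<Sum>Y\<in>?NX. sum \<omega> {E \<in> {E \<in> ?G. nx E = Y}. ?par E (Y \<union> set ys \<union> ?K) \<and> stuck E (Y \<union> set ys \<union> ?K)})
    \<le> (\<Sum>Y\<in>?NX. ?rate * sum \<omega> {E \<in> ?G. nx E = Y})"
    by (intro sum_mono part)
  moreover have "(\<Sum>Y\<in>?NX. ?rate * sum \<omega> {E \<in> ?G. nx E = Y}) = ?rate * (\<Sum>Y\<in>?NX. sum \<omega> {E \<in> ?G. nx E = Y})"
    by (rule sum_distrib_left[symmetric])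
  moreover have "(\<Sum>Y\<in>?NX. sum \<omega> {E \<in> ?G. nx E = Y}) = sum \<omega> ?G"
    using fin by (intro sum.group) auto
  moreover have "sum \<omega> {E \<in> \<Omega>. ?bad E} \<le> miss ^ t * sum \<omega> \<Omega>"
    using no_helper_mass[OF finbt \<Omega> RV, of z y] bt z Cons.prems(10)[of _ y] by auto
  moreover have "?rate * sum \<omega> ?G \<le> ?rate * sum \<omega> \<Omega>"
    using \<Omega> miss_bounds decay_bounds offset_ge by (intro mult_left_mono mass_mono) auto
  ultimately have "sum \<omega> {E \<in> \<Omega>. ?par E ?R \<and> stuck E ?R} \<le>
      miss ^ t * sum \<omega> \<Omega> + ?rate * sum \<omega> \<Omega>"
    by (rule chain)
  also have "\<dots> = (real (length (y # ys)) * miss ^ t + decay ^ card W * (real (card D) + offset)) * sum \<omega> \<Omega>"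
    by (simp add: algebra_simps)
  finally show ?case .
qed

end

text \<open>
  The exception \<open>S = {}\<close> forces \<open>z\<close> and the first selected vertex to be adjacent iff the number of
  edges of the whole graph is odd.
\<close>

definition accepts :: "bool \<Rightarrow> 'a set set \<Rightarrow> 'a \<Rightarrow> 'a set \<Rightarrow> 'a \<Rightarrow> bool" where
  "accepts b E z S v \<longleftrightarrow> (odd (deg_in E (insert z S) v) \<longleftrightarrow> \<not> b \<and> S = {})"

text \<open>The greedy choice in increasing order, put as a condition on its result so that graphs
  can be classified by the chain they produce.\<close>

definition selected :: "bool \<Rightarrow> 'a::linorder set set \<Rightarrow> 'a \<Rightarrow> 'a set \<Rightarrow> 'a set \<Rightarrow> bool" where
  "selected b E z P W \<longleftrightarrow> W \<subseteq> P \<and> (\<forall>v\<in>P. v \<in> W \<longleftrightarrow> accepts b E z {w \<in> W. w < v} v)"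

lemma selected_insert_max:
  assumes "\<forall>a\<in>P. a < m" "W \<subseteq> P"
  shows "selected b E z (insert m P) W \<longleftrightarrow> selected b E z P W \<and> \<not> accepts b E z W m"
    and "selected b E z (insert m P) (insert m W) \<longleftrightarrow> selected b E z P W \<and> accepts b E z W m"
proof -
  have m: "m \<notin> W" "m \<notin> P" using assms by auto
  have 1: "{w \<in> W. w < m} = W" "{w \<in> insert m W. w < m} = W" using assms by auto
  have 2: "{w \<in> insert m W. w < v} = {w \<in> W. w < v}" if "v \<in> P" for v
    using assms that by fastforce
  show "selected b E z (insert m P) W \<longleftrightarrow> selected b E z P W \<and> \<not> accepts b E z W m"
    unfolding selected_def using 1 m assms by auto
  have "(\<forall>v\<in>P. v \<in> insert m W \<longleftrightarrow> accepts b E z {w \<in> insert m W. w < v} v) \<longleftrightarrow>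
      (\<forall>v\<in>P. v \<in> W \<longleftrightarrow> accepts b E z {w \<in> W. w < v} v)"
    using m 2 by (intro ball_cong refl) auto
  then show "selected b E z (insert m P) (insert m W) \<longleftrightarrow> selected b E z P W \<and> accepts b E z W m"
    unfolding selected_def using 1 m assms by auto
qed

lemma selected_exists: "finite P \<Longrightarrow> \<exists>W. selected b E z P W"
proof (induction P rule: finite_linorder_max_induct)
  case (insert m P)
  then obtain W where W: "selected b E z P W" by auto
  then have "W \<subseteq> P" by (simp add: selected_def)
  then show ?case using selected_insert_max[OF insert.hyps(2), of W b E z] W by blast
qed (auto simp: selected_def)

context flip_weight
begin

text \<open>Generating function of the chain length. Toggling \<open>{m, z}\<close> flips the
  acceptance of the largest vertex \<open>m\<close> and no earlier decision, so each vertex is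
  accepted with conditional probability at least \<open>1 / (2 * \<rho>)\<close>.\<close>

lemma selected_weight:
  assumes "finite P" "z \<notin> P" "z \<in> V" "P \<subseteq> V" "0 \<le> \<gamma>" "\<gamma> \<le> 1" and \<Omega>: "\<Omega> \<subseteq> Pow (vertex_pairs V)"
    and closed: "\<And>E v. E \<in> \<Omega> \<Longrightarrow> v \<in> P \<Longrightarrow> toggle E {{v, z}} \<in> \<Omega>"
  shows "(\<Sum>W\<in>Pow P. \<gamma> ^ card W * sum \<omega> {E \<in> \<Omega>. selected b E z P W})
    \<le> (1 - (1 - \<gamma>) / (2 * \<rho>)) ^ card P * sum \<omega> \<Omega>"
  using assms(1,2,4) closed
proof (induction P rule: finite_linorder_max_induct)
  case empty
  then show ?case by (simp add: selected_def)
next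
  case (insert m P)
  note fin\<Omega> = finite_graphs[OF \<Omega>]
  let ?\<kappa> = "1 - (1 - \<gamma>) / (2 * \<rho>)"
  have m: "m \<notin> P" "m \<noteq> z" "m \<in> V" using insert by auto
  have \<kappa>: "0 \<le> ?\<kappa>" using assms(5,6) rho by (simp add: divide_le_eq)
  let ?S = "\<lambda>W. {E \<in> \<Omega>. selected b E z P W}"
  let ?T = "\<lambda>W. {E \<in> ?S W. accepts b E z W m}"
  have acc: "1 / (2 * \<rho>) * sum \<omega> (?S W) \<le> sum \<omega> (?T W)" if "W \<subseteq> P" for W
  proof -
    have finW: "finite W" using that insert.hyps finite_subset by blast
    have mW: "m \<notin> W" using that m by auto
    have S: "?S W \<subseteq> Pow (vertex_pairs V)" using \<Omega> by auto
    let ?F = "{{}, {{m, z}}}"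
    have sel: "selected b (toggle E {{m, z}}) z P W \<longleftrightarrow> selected b E z P W" for E
    proof -
      have "v \<noteq> m" "v \<noteq> z" if "v \<in> P" for v using that m insert.prems by auto
      then show ?thesis unfolding selected_def accepts_def using finW
        by (simp add: deg_in_edge_same)
    qed
    have flip: "accepts b (toggle E {{m, z}}) z W m \<longleftrightarrow> \<not> accepts b E z W m" for E
      unfolding accepts_def using finW m by (simp add: deg_in_edge_flip) blast
    have "sum \<omega> (?S W) \<le> real (card ?F) * \<rho> ^ 1 * sum \<omega> (?T W)"
    proof (rule mass_le_reachable[OF S])
      fix T assume "T \<in> ?F"
      then show "T \<subseteq> vertex_pairs V \<and> card T \<le> 1"
        using m assms(3) by (auto simp: vertex_pairs_def)
    next
      fix E assume "E \<in> ?S W"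
      then show "\<exists>T\<in>?F. toggle E T \<in> ?S W \<and> accepts b (toggle E T) z W m"
        using flip[of E] sel[of E] insert.prems(3)[of E m] by (cases "accepts b E z W m") auto
    qed simp
    then show ?thesis using rho by (simp add: pos_divide_le_eq mult.commute)
  qed
  have split: "sum \<omega> {E \<in> \<Omega>. selected b E z (insert m P) W} = sum \<omega> (?S W) - sum \<omega> (?T W)"
    "sum \<omega> {E \<in> \<Omega>. selected b E z (insert m P) (insert m W)} = sum \<omega> (?T W)"
    "card (insert m W) = Suc (card W)" if "W \<in> Pow P" for W
  proof -
    have W: "W \<subseteq> P" using that by simp
    note eq = selected_insert_max[OF insert.hyps(2) W]
    have "?S W = {E \<in> \<Omega>. selected b E z (insert m P) W} \<union> ?T W"
      "{E \<in> \<Omega>. selected b E z (insert m P) W} \<inter> ?T W = {}" unfolding eq by auto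
    then have "sum \<omega> (?S W) = sum \<omega> {E \<in> \<Omega>. selected b E z (insert m P) W} + sum \<omega> (?T W)"
      using fin\<Omega> sum.union_disjoint[of "{E \<in> \<Omega>. selected b E z (insert m P) W}" "?T W" \<omega>]
      by (metis (no_types, lifting) finite_Un finite_subset mem_Collect_eq subsetI)
    then show "sum \<omega> {E \<in> \<Omega>. selected b E z (insert m P) W} = sum \<omega> (?S W) - sum \<omega> (?T W)" by simp
    show "sum \<omega> {E \<in> \<Omega>. selected b E z (insert m P) (insert m W)} = sum \<omega> (?T W)"
      unfolding eq by (rule arg_cong[of _ _ "sum \<omega>"]) auto
    show "card (insert m W) = Suc (card W)"
      using W m insert.hyps finite_subset[OF W] by (subst card_insert_disjoint) auto
  qed
  have "Pow P \<inter> insert m ` Pow P = {}" "inj_on (insert m) (Pow P)"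
    using m by (auto simp: inj_on_def)
  then have "(\<Sum>W\<in>Pow (insert m P). \<gamma> ^ card W * sum \<omega> {E \<in> \<Omega>. selected b E z (insert m P) W}) =
    (\<Sum>W\<in>Pow P. \<gamma> ^ card W * sum \<omega> {E \<in> \<Omega>. selected b E z (insert m P) W}) +
    (\<Sum>W\<in>Pow P. \<gamma> ^ card (insert m W) * sum \<omega> {E \<in> \<Omega>. selected b E z (insert m P) (insert m W)})"
    using insert.hyps by (simp add: Pow_insert sum.union_disjoint sum.reindex)
  also have "\<dots> = (\<Sum>W\<in>Pow P. \<gamma> ^ card W * (sum \<omega> (?S W) - (1 - \<gamma>) * sum \<omega> (?T W)))"
    unfolding sum.distrib[symmetric] by (intro sum.cong) (simp_all add: split algebra_simps)
  also have "\<dots> \<le> (\<Sum>W\<in>Pow P. \<gamma> ^ card W * (?\<kappa> * sum \<omega> (?S W)))"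
  proof (intro sum_mono mult_left_mono)
    fix W assume "W \<in> Pow P"
    then have "(1 - \<gamma>) * (1 / (2 * \<rho>) * sum \<omega> (?S W)) \<le> (1 - \<gamma>) * sum \<omega> (?T W)"
      using acc assms(6) by (intro mult_left_mono) auto
    then show "sum \<omega> (?S W) - (1 - \<gamma>) * sum \<omega> (?T W) \<le> ?\<kappa> * sum \<omega> (?S W)"
      by (simp add: left_diff_distrib)
  qed (use assms(5) in auto)
  also have "\<dots> = ?\<kappa> * (\<Sum>W\<in>Pow P. \<gamma> ^ card W * sum \<omega> (?S W))"
    by (simp add: sum_distrib_left mult.left_commute)
  also have "\<dots> \<le> ?\<kappa> * (?\<kappa> ^ card P * sum \<omega> \<Omega>)"
    using insert \<kappa> by (intro mult_left_mono insert.IH) auto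
  finally show ?case using m insert.hyps by (simp add: mult.assoc)
qed

end

section \<open>The revealed graph\<close>

lemma deg_in_insert_self [simp]: "deg_in E (insert v R) v = deg_in E R v"
  by (simp add: deg_in_def)

lemma deg_in_edge_outside:
  assumes "finite R" "u \<notin> R" "v \<noteq> u"
  shows "even (deg_in (toggle E {{u, y}}) R v) \<longleftrightarrow> even (deg_in E R v)"
proof -
  have *: "{w \<in> R - {v}. {v, w} \<in> {{u, y}}} = {}"
    using assms by (auto simp: doubleton_eq_iff)
  show ?thesis unfolding even_deg_in_toggle[OF assms(1)] * by simp
qed

lemma degree_eq_deg_in:
  assumes "E \<subseteq> vertex_pairs V" "a \<in> V" "finite V"
  shows "degree E a = deg_in E V a"
proof -
  have "{e \<in> E. a \<in> e} = (\<lambda>w. {a, w}) ` {w \<in> V - {a}. {a, w} \<in> E}"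
  proof
    show "{e \<in> E. a \<in> e} \<subseteq> (\<lambda>w. {a, w}) ` {w \<in> V - {a}. {a, w} \<in> E}"
    proof
      fix e assume e: "e \<in> {e \<in> E. a \<in> e}"
      then have "e \<subseteq> V" "card e = 2" using assms(1) by (auto simp: vertex_pairs_def)
      then obtain w where "e = {a, w}" "w \<noteq> a" using e by (auto simp: card_2_iff)
      then show "e \<in> (\<lambda>w. {a, w}) ` {w \<in> V - {a}. {a, w} \<in> E}" using e \<open>e \<subseteq> V\<close> by auto
    qed
  qed auto
  then show ?thesis unfolding degree_def deg_in_def
    by (simp add: card_image inj_on_def doubleton_eq_iff)
qed

lemma induced_edges_toggle:
  "(\<And>e. e \<in> T \<Longrightarrow> \<not> e \<subseteq> A) \<Longrightarrow> induced_edges (toggle E T) A = induced_edges E A"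
  by (auto simp: induced_edges_def)

text \<open>The edge parity is left out so that the family is closed under toggling single edges
  outside \<open>A\<close>; \<open>exposed_parity_mass\<close> brings it back.\<close>

definition exposed_graphs ::
    "'a set \<Rightarrow> 'a set \<Rightarrow> 'a set set \<Rightarrow> ('a \<Rightarrow> bool) \<Rightarrow> 'a set set set" where
  "exposed_graphs V A H d =
    {E \<in> Pow (vertex_pairs V). induced_edges E A = H \<and> (\<forall>a\<in>A. even (degree E a) = d a)}"

context flip_weight
begin

context
  fixes A P :: "'a set" and z :: 'a and bt :: "'a \<Rightarrow> 'a set" and t :: nat
    and H :: "'a set set" and d :: "'a \<Rightarrow> bool" and b :: bool
  assumes AV: "A \<subseteq> V" and PV: "P \<subseteq> V - A" and zV: "z \<in> V - A - P"
    and bt: "\<And>v. v \<in> P \<Longrightarrow> bt v \<subseteq> V - A - P - {z} \<and> card (bt v) = t"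
    and bt_disjoint: "\<And>u v. u \<in> P \<Longrightarrow> v \<in> P \<Longrightarrow> u \<noteq> v \<Longrightarrow> bt u \<inter> bt v = {}"
begin

abbreviation (input) exposed :: "'a set set set" where
  "exposed \<equiv> exposed_graphs V A H d"

lemma exposed_subset: "exposed \<subseteq> Pow (vertex_pairs V)"
  by (auto simp: exposed_graphs_def)

lemma exposed_edge:
  assumes E: "E \<in> exposed" and uv: "u \<in> V - A" "v \<in> V - A" "u \<noteq> v"
  shows "toggle E {{u, v}} \<in> exposed"
proof -
  have sub: "toggle E {{u, v}} \<subseteq> vertex_pairs V" "E \<subseteq> vertex_pairs V"
    using E uv by (auto simp: exposed_graphs_def vertex_pairs_def)
  have "even (degree (toggle E {{u, v}}) a) \<longleftrightarrow> even (degree E a)" if "a \<in> A" for a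
  proof -
    have "a \<in> V" "a \<noteq> u" "a \<noteq> v" using that uv AV by auto
    then show ?thesis using sub finite_V by (simp add: degree_eq_deg_in deg_in_edge_same)
  qed
  moreover have "induced_edges (toggle E {{u, v}}) A = induced_edges E A"
    using uv by (intro induced_edges_toggle) auto
  ultimately show ?thesis using E sub by (auto simp: exposed_graphs_def)
qed

text \<open>Here \<open>x\<close> may lie in \<open>A\<close>: neither edge of its arm is inside
  \<open>A\<close>, and they cancel in its degree. So the adjacency of an exposed vertex to the
  chain can still be varied although its degree parity is revealed.\<close>

lemma exposed_arm:
  assumes E: "E \<in> exposed" and xw: "x \<in> V" "w \<in> V - A" "x \<noteq> w" "x \<noteq> z" "w \<noteq> z"
  shows "toggle E (arm z x w) \<in> exposed"
proof -
  have "arm z x w \<subseteq> vertex_pairs V" using xw zV by (intro arm_subset) auto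
  then have sub: "toggle E (arm z x w) \<subseteq> vertex_pairs V" "E \<subseteq> vertex_pairs V"
    using E toggle_subset by (auto simp: exposed_graphs_def)
  have "even (degree (toggle E (arm z x w)) a) \<longleftrightarrow> even (degree E a)" if "a \<in> A" for a
  proof -
    have "even (deg_in (toggle E (arm z x w)) V a) \<longleftrightarrow> even (deg_in E V a)"
      using that xw zV finite_V by (intro deg_in_arm_same) auto
    then show ?thesis using sub that AV finite_V by (auto simp: degree_eq_deg_in)
  qed
  moreover have "induced_edges (toggle E (arm z x w)) A = induced_edges E A"
    using xw zV by (intro induced_edges_toggle) (auto simp: arm_def)
  ultimately show ?thesis using E sub by (auto simp: exposed_graphs_def)
qed

lemma edges_in_V: "E \<subseteq> vertex_pairs V \<Longrightarrow> edges_in E V = card E"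
  unfolding edges_in_def by (rule arg_cong[of _ _ card]) auto

text \<open>Toggling an edge from the reservoir to \<open>z\<close> switches the parity of the edge
  count.\<close>

lemma exposed_parity_mass:
  assumes "P \<noteq> {}"
  shows "sum \<omega> exposed \<le> 2 * \<rho> * sum \<omega> {E \<in> exposed. even (card E) = b}"
proof -
  from assms obtain v where v: "v \<in> P" by auto
  let ?e = "{v, z}"
  have vz: "v \<in> V - A" "z \<in> V - A" "v \<noteq> z" using v PV zV by auto
  have flip: "even (card (toggle E {?e})) \<longleftrightarrow> odd (card E)" if "E \<subseteq> vertex_pairs V" for E
  proof -
    have fin: "finite E" using that finite_vertex_pairs[OF finite_V] finite_subset by blast
    show ?thesis
    proof (cases "?e \<in> E")
      case True
      then have "toggle E {?e} = E - {?e}" "card E = Suc (card (E - {?e}))"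
        using fin card_Suc_Diff1[of E ?e] by (auto simp: toggle_def)
      then show ?thesis by simp
    next
      case False
      then have "toggle E {?e} = insert ?e E" by (auto simp: toggle_def)
      then show ?thesis using False fin by simp
    qed
  qed
  have "sum \<omega> exposed \<le> real (card {{}, {?e}}) * \<rho> ^ 1 * sum \<omega> {E \<in> exposed. even (card E) = b}"
  proof (rule mass_le_reachable[OF exposed_subset])
    fix T assume "T \<in> {{}, {?e}}"
    then show "T \<subseteq> vertex_pairs V \<and> card T \<le> 1" using vz by (auto simp: vertex_pairs_def)
  next
    fix E assume E: "E \<in> exposed"
    then show "\<exists>T\<in>{{}, {?e}}. toggle E T \<in> exposed \<and> even (card (toggle E T)) = b"
      using flip[of E] exposed_edge[OF E vz] exposed_subset by (cases "even (card E) = b") auto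
  qed simp
  then show ?thesis by simp
qed

text \<open>The root and the least chain member form the final pair \<open>B\<close>. The division
  by \<open>decay\<close> makes up for the member spent on it.\<close>

lemma selected_failure_mass:
  assumes WP: "W \<subseteq> P"
  shows "sum \<omega> {E \<in> {E \<in> exposed. selected b E z P W}. even (card E) = b \<and> \<not> even_degenerate V E}
    \<le> (real (card P) * miss ^ t + (real (card V) + offset) / decay * decay ^ card W) *
      sum \<omega> {E \<in> exposed. selected b E z P W}"
proof -
  let ?\<Omega> = "{E \<in> exposed. selected b E z P W}"
  have \<Omega>: "?\<Omega> \<subseteq> Pow (vertex_pairs V)" using exposed_subset by auto
  have M: "0 \<le> sum \<omega> ?\<Omega>" using \<Omega> by (rule mass_nonneg)
  have finP: "finite P" using PV finite_V finite_subset by blast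
  have finW: "finite W" using WP finP finite_subset by blast
  show ?thesis
  proof (cases "W = {}")
    case True
    \<comment> \<open>Without a chain the claimed factor is at least 1.\<close>
    have "1 \<le> (real (card V) + offset) / decay"
      using offset_ge decay_bounds by (simp add: pos_le_divide_eq)
    then have "1 \<le> real (card P) * miss ^ t + (real (card V) + offset) / decay * decay ^ card W"
      using True miss_bounds by (simp add: add_increasing)
    then have "1 * sum \<omega> ?\<Omega> \<le> (real (card P) * miss ^ t + (real (card V) + offset) / decay * decay ^ card W) * sum \<omega> ?\<Omega>"
      using M by (rule mult_right_mono)
    moreover have "sum \<omega> {E \<in> ?\<Omega>. even (card E) = b \<and> \<not> even_degenerate V E} \<le> sum \<omega> ?\<Omega>"
      using \<Omega> by (intro mass_mono) auto
    ultimately show ?thesis by linarith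
  next
    case False
    define w1 where "w1 = Min W"
    define W' where "W' = W - {w1}"
    define B where "B = {z, w1}"
    \<comment> \<open>Everything outside the reservoir and the root, in particular \<open>A\<close>
      and the batches, starts in \<open>X\<close>.\<close>
    define D where "D = V - P - {z}"
    define ys where "ys = sorted_list_of_set (P - W)"
    have w1: "w1 \<in> W" "\<And>w. w \<in> W' \<Longrightarrow> w1 < w"
      using False finW by (auto simp: w1_def W'_def less_le)
    have ys: "set ys = P - W" "distinct ys" "length ys = card (P - W)"
      using finP by (auto simp: ys_def)
    have w1z: "w1 \<noteq> z" "w1 \<in> V" using w1 WP PV zV by auto
    have V_eq: "D \<union> set ys \<union> (B \<union> W') = V"
      using w1 WP PV zV unfolding ys by (auto simp: D_def B_def W'_def)
    have decided: "accepts b E z {w \<in> W. w < v} v" if "E \<in> ?\<Omega>" "v \<in> W" for E v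
      using that WP by (auto simp: selected_def)
    \<comment> \<open>The special rule for the first member gives \<open>B\<close> the revealed edge
      parity of the whole graph, as the parity invariant demands.\<close>
    have edges_B: "even (edges_in E B) \<longleftrightarrow> b" if "E \<in> ?\<Omega>" for E
    proof -
      have none: "{w \<in> W. w < w1} = {}" using w1(2) unfolding W'_def by fastforce
      have "odd (deg_in E {z} w1) \<longleftrightarrow> \<not> b"
        using decided[OF that w1(1)] unfolding none accepts_def by simp
      moreover have "edges_in E {w1, z} = edges_in E ({w1, z} - {w1}) + deg_in E {w1, z} w1"
        by (intro edges_in_remove) auto
      moreover have "{w1, z} - {w1} = {z}" using w1z by auto
      moreover have "vertex_pairs {z} = {}"
        by (auto simp: vertex_pairs_def subset_singleton_iff)
      ultimately show ?thesis by (simp add: B_def insert_commute edges_in_def)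
    qed
    have "sum \<omega> {E \<in> ?\<Omega>. even (card E) = b \<and> \<not> even_degenerate V E} \<le>
      sum \<omega> {E \<in> ?\<Omega>. (even (edges_in E (D \<union> set ys \<union> (B \<union> W'))) \<longleftrightarrow> even (edges_in E B)) \<and>
        stuck E (D \<union> set ys \<union> (B \<union> W'))}"
    proof (rule mass_mono)
      show "{E \<in> ?\<Omega>. even (card E) = b \<and> \<not> even_degenerate V E} \<subseteq>
        {E \<in> ?\<Omega>. (even (edges_in E (D \<union> set ys \<union> (B \<union> W'))) \<longleftrightarrow> even (edges_in E B)) \<and>
          stuck E (D \<union> set ys \<union> (B \<union> W'))}"
        unfolding V_eq
      proof
        fix E assume E: "E \<in> {E \<in> ?\<Omega>. even (card E) = b \<and> \<not> even_degenerate V E}"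
        then have "stuck E V" using elim_even_degenerate[OF _ finite_V] by (auto simp: stuck_def)
        moreover have "edges_in E V = card E" using E \<Omega> by (intro edges_in_V) auto
        ultimately show "E \<in> {E \<in> ?\<Omega>. (even (edges_in E V) \<longleftrightarrow> even (edges_in E B)) \<and> stuck E V}"
          using E edges_B[of E] by simp
      qed
    qed (use \<Omega> in auto)
    also have "\<dots> \<le> (real (length ys) * miss ^ t + decay ^ card W' * (real (card D) + offset)) * sum \<omega> ?\<Omega>"
    proof (rule stuck_rejects_mass)
      show "bt y \<subseteq> D \<and> card (bt y) = t" if "y \<in> set ys" for y
        using bt[of y] that unfolding ys by (auto simp: D_def)
      show "bt y \<inter> bt y' = {}" if "y \<in> set ys" "y' \<in> set ys" "y \<noteq> y'" for y y'
        using bt_disjoint[of y y'] that unfolding ys by auto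
      show "even (deg_in E (B \<union> {v \<in> W'. v < w}) w)" if "E \<in> ?\<Omega>" "w \<in> W'" for E w
      proof -
        have "w \<in> W" "w1 < w" using that w1 by (auto simp: W'_def)
        then have lower: "insert z {v \<in> W. v < w} = B \<union> {v \<in> W'. v < w}"
          and nonempty: "{v \<in> W. v < w} \<noteq> {}"
          using w1(1) by (auto simp: B_def W'_def)
        show ?thesis
          using decided[OF that(1) \<open>w \<in> W\<close>] nonempty unfolding accepts_def lower by blast
      qed
      show "toggle E (arm z x w) \<in> ?\<Omega>"
        if E: "E \<in> ?\<Omega>" and w: "w \<in> W'" and x: "x \<in> D \<or> x \<in> W' \<and> w < x" for E x w
      proof -
        have wx: "w \<in> W" "w \<in> P" "w \<in> V - A" "w \<noteq> z" "x \<in> V" "x \<noteq> z" "x \<noteq> w"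
          "x \<in> P \<Longrightarrow> x \<in> W \<and> w < x"
          using w x WP PV zV by (auto simp: W'_def D_def)
        \<comment> \<open>A larger chain member \<open>x\<close> sees both \<open>w\<close> and
          \<open>z\<close> when tested, so its arm cancels; the test of \<open>w\<close> does not
          see \<open>x\<close>.\<close>
        have "even (deg_in (toggle E (arm z x w)) (insert z {u \<in> W. u < v}) v) \<longleftrightarrow>
            even (deg_in E (insert z {u \<in> W. u < v}) v)" if "v \<in> P" for v
          using that wx zV finW WP by (intro deg_in_arm_same) auto
        then have "selected b (toggle E (arm z x w)) z P W \<longleftrightarrow> selected b E z P W"
          by (simp add: selected_def accepts_def)
        then show ?thesis using E exposed_arm[of E x w] wx by simp
      qed
      show "toggle E {{u, z}} \<in> ?\<Omega> \<and> toggle E {{u, y}} \<in> ?\<Omega>"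
        if E: "E \<in> ?\<Omega>" and y: "y \<in> set ys" and u: "u \<in> bt y" for E y u
      proof -
        have uy: "y \<in> P" "y \<in> V - A" "u \<in> V - A" "u \<notin> P" "u \<noteq> z" "u \<noteq> y"
          using bt[of y] y u PV unfolding ys by auto
        \<comment> \<open>Batch vertices lie outside the reservoir, so no selection test sees
          them.\<close>
        have "even (deg_in (toggle E {{u, q}}) (insert z {v' \<in> W. v' < v}) v) \<longleftrightarrow>
            even (deg_in E (insert z {v' \<in> W. v' < v}) v)" if "v \<in> P" for v q
          using that uy finW WP by (intro deg_in_edge_outside) auto
        then have "selected b (toggle E {{u, q}}) z P W \<longleftrightarrow> selected b E z P W" for q
          by (simp add: selected_def accepts_def)
        then show ?thesis
          using E exposed_edge[of E u z] exposed_edge[of E u y] uy zV by simp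
      qed
    qed (use \<Omega> w1z w1 zV PV WP ys in \<open>auto simp: B_def W'_def D_def\<close>)
    also have "\<dots> \<le> (real (card P) * miss ^ t + (real (card V) + offset) / decay * decay ^ card W) * sum \<omega> ?\<Omega>"
    proof (rule mult_right_mono[OF _ M], rule add_mono)
      have "card (P - W) \<le> card P" using finP by (intro card_mono) auto
      then show "real (length ys) * miss ^ t \<le> real (card P) * miss ^ t"
        using ys miss_bounds by (intro mult_right_mono) auto
      have "card D \<le> card V" using finite_V by (intro card_mono) (auto simp: D_def)
      moreover have "card W = Suc (card W')"
        unfolding W'_def by (rule card_Suc_Diff1[OF finW w1(1), symmetric])
      ultimately show "decay ^ card W' * (real (card D) + offset) \<le>
          (real (card V) + offset) / decay * decay ^ card W"
        using decay_bounds by (simp add: mult.commute)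
    qed
    finally show ?thesis .
  qed
qed

text \<open>Sum over all chains: \<open>selected_weight\<close> with \<open>\<gamma> = 1\<close>
  keeps the total over the classes below the whole mass, and with \<open>\<gamma> = decay\<close> it
  averages \<open>decay ^ card W\<close>.\<close>

lemma failure_mass:
  shows "sum \<omega> {E \<in> exposed. even (card E) = b \<and> \<not> even_degenerate V E} \<le>
    (real (card P) * miss ^ t +
      (real (card V) + offset) / decay * (1 - (1 - decay) / (2 * \<rho>)) ^ card P) * sum \<omega> exposed"
proof -
  let ?Q = "\<lambda>E. even (card E) = b \<and> \<not> even_degenerate V E"
  let ?S = "\<lambda>W. {E \<in> exposed. selected b E z P W}"
  let ?c = "(real (card V) + offset) / decay"
  have finP: "finite P" using PV finite_V finite_subset by blast
  note fin = finite_graphs[OF exposed_subset]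
  have "sum \<omega> {E \<in> exposed. ?Q E} \<le>
      (\<Sum>E\<in>{E \<in> exposed. ?Q E}. \<Sum>W\<in>Pow P. if selected b E z P W then \<omega> E else 0)"
  proof (rule sum_mono)
    fix E assume E: "E \<in> {E \<in> exposed. ?Q E}"
    then have "0 \<le> \<omega> E" using exposed_subset weight_nonneg by auto
    moreover obtain W where W: "selected b E z P W" using selected_exists[OF finP] by blast
    moreover from W have "W \<in> Pow P" by (simp add: selected_def)
    ultimately show "\<omega> E \<le> (\<Sum>W\<in>Pow P. if selected b E z P W then \<omega> E else 0)"
      using member_le_sum[of W "Pow P" "\<lambda>W. if selected b E z P W then \<omega> E else 0"] finP by simp
  qed
  also have "\<dots> = (\<Sum>W\<in>Pow P. sum \<omega> {E \<in> ?S W. ?Q E})"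
    using fin by (subst sum.swap) (auto simp: sum.If_cases intro!: sum.cong)
  also have "\<dots> \<le> (\<Sum>W\<in>Pow P. (real (card P) * miss ^ t + ?c * decay ^ card W) * sum \<omega> (?S W))"
    by (intro sum_mono selected_failure_mass) auto
  also have "\<dots> = real (card P) * miss ^ t * (\<Sum>W\<in>Pow P. 1 ^ card W * sum \<omega> (?S W)) +
      ?c * (\<Sum>W\<in>Pow P. decay ^ card W * sum \<omega> (?S W))"
    by (simp add: sum_distrib_left sum.distrib distrib_right mult.assoc)
  also have "\<dots> \<le> real (card P) * miss ^ t * sum \<omega> exposed +
      ?c * ((1 - (1 - decay) / (2 * \<rho>)) ^ card P * sum \<omega> exposed)"
  proof (intro add_mono mult_left_mono)
    have closed: "toggle E {{v, z}} \<in> exposed" if "E \<in> exposed" "v \<in> P" for E v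
      using that PV zV by (intro exposed_edge) auto
    show "(\<Sum>W\<in>Pow P. 1 ^ card W * sum \<omega> (?S W)) \<le> sum \<omega> exposed"
    proof -
      have "(\<Sum>W\<in>Pow P. 1 ^ card W * sum \<omega> (?S W)) \<le> (1 - (1 - 1) / (2 * \<rho>)) ^ card P * sum \<omega> exposed"
        using closed exposed_subset zV PV finP by (intro selected_weight) auto
      then show ?thesis by simp
    qed
    show "(\<Sum>W\<in>Pow P. decay ^ card W * sum \<omega> (?S W)) \<le>
        (1 - (1 - decay) / (2 * \<rho>)) ^ card P * sum \<omega> exposed"
      using closed exposed_subset zV PV finP decay_bounds by (intro selected_weight) auto
  qed (use miss_bounds decay_bounds offset_ge in auto)
  finally show ?thesis by (simp add: algebra_simps)
qed

end

end

section \<open>Transfer to the random graph and choice of parameters\<close>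

lemma gnp_flip_weight:
  fixes V :: "'a::linorder set"
  assumes "finite V" "0 < p" "p < 1"
  shows "flip_weight V (pmf (gnp V p)) (max (p / (1 - p)) ((1 - p) / p))"
proof
  let ?\<rho> = "max (p / (1 - p)) ((1 - p) / p)"
  let ?w = "pmf (gnp V p)"
  show "finite V" by fact
  show "1 \<le> ?\<rho>"
  proof (cases "p \<le> 1/2")
    case True
    then have "1 \<le> (1 - p) / p" using assms by (simp add: le_divide_eq)
    then show ?thesis by simp
  next
    case False
    then have "1 \<le> p / (1 - p)" using assms by (simp add: le_divide_eq)
    then show ?thesis by simp
  qed
  show "0 \<le> ?w E" for E by simp
  have step: "?w E \<le> ?\<rho> * ?w (insert e E) \<and> ?w (insert e E) \<le> ?\<rho> * ?w E"
    if E: "E \<subseteq> vertex_pairs V" "e \<in> vertex_pairs V" "e \<notin> E" for E e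
  proof -
    let ?N = "card V choose 2"
    have "finite E" using E finite_vertex_pairs[OF assms(1)] finite_subset by blast
    then have card: "card (insert e E) = Suc (card E)" using E by simp
    have "Suc (card E) \<le> ?N"
      using card_mono[OF finite_vertex_pairs[OF assms(1)], of "insert e E"] E card
      by (simp add: card_vertex_pairs[OF assms(1)])
    then have "?N - card E = Suc (?N - Suc (card E))" by simp
    \<comment> \<open>Adding an edge multiplies the probability by
      \<open>p / (1 - p)\<close>.\<close>
    then have eq: "(1 - p) * ?w (insert e E) = p * ?w E"
      using E card by (simp add: pmf_gnp[OF assms])
    have w1: "?w E = (1 - p) / p * ?w (insert e E)" using eq assms by (simp add: field_simps)
    have w2: "?w (insert e E) = p / (1 - p) * ?w E" using eq assms by (simp add: field_simps)
    show ?thesis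
    proof
      show "?w E \<le> ?\<rho> * ?w (insert e E)" by (subst w1) (intro mult_right_mono, auto)
      show "?w (insert e E) \<le> ?\<rho> * ?w E" by (subst w2) (intro mult_right_mono, auto)
    qed
  qed
  show "?w E \<le> ?\<rho> * ?w (toggle E {e})" if E: "E \<subseteq> vertex_pairs V" "e \<in> vertex_pairs V" for E e
  proof (cases "e \<in> E")
    case True
    then have "toggle E {e} = E - {e}" "insert e (E - {e}) = E" by (auto simp: toggle_def)
    then show ?thesis using step[of "E - {e}" e] E by auto
  next
    case False
    then have "toggle E {e} = insert e E" by (auto simp: toggle_def)
    then show ?thesis using step[of E e] E False by auto
  qed
qed


text \<open>The batches are cut out of \<open>N * N\<close> further vertices along a bijection with
  \<open>P \<times> {..<N}\<close>.\<close>

lemma batches_exist: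
  assumes "finite S" "1 + N + N * N \<le> card S"
  obtains z P bt where "P \<subseteq> S" "card P = N" "z \<in> S - P"
    "\<And>v. v \<in> P \<Longrightarrow> bt v \<subseteq> S - P - {z} \<and> card (bt v) = N"
    "\<And>u v. u \<in> P \<Longrightarrow> v \<in> P \<Longrightarrow> u \<noteq> v \<Longrightarrow> bt u \<inter> bt v = {}"
proof -
  obtain P where P: "P \<subseteq> S" "card P = N" using obtain_subset_with_card_n[of N S] assms by auto
  have finP: "finite P" using P assms finite_subset by blast
  have "card (S - P) = card S - N" using P finP by (simp add: card_Diff_subset)
  then have SP: "1 + N * N \<le> card (S - P)" using assms by linarith
  then obtain z where z: "z \<in> S - P" by (metis card.empty add_is_0 le_zero_eq one_neq_zero ex_in_conv)
  have "card (S - P - {z}) = card (S - P) - 1" using z by simp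
  then have "N * N \<le> card (S - P - {z})" using SP by linarith
  then obtain U where U: "U \<subseteq> S - P - {z}" "card U = N * N" "finite U"
    using obtain_subset_with_card_n by metis
  have "card (P \<times> {..<N}) = card U" using P U by (simp add: card_cartesian_product)
  then obtain g where g: "bij_betw g (P \<times> {..<N}) U"
    using finite_same_card_bij finP U by (metis finite_cartesian_product finite_lessThan)
  define bt where "bt v = g ` ({v} \<times> {..<N})" for v
  have inj: "inj_on g (P \<times> {..<N})" using g by (simp add: bij_betw_def)
  have "bt v \<subseteq> S - P - {z} \<and> card (bt v) = N" if "v \<in> P" for v
  proof
    have sub: "{v} \<times> {..<N} \<subseteq> P \<times> {..<N}" using that by auto
    have "bt v \<subseteq> U" unfolding bt_def using g sub by (auto simp: bij_betw_def)
    then show "bt v \<subseteq> S - P - {z}" using U by auto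
    have "card (bt v) = card ({v} \<times> {..<N})"
      unfolding bt_def using inj_on_subset[OF inj sub] by (rule card_image)
    then show "card (bt v) = N" by (simp add: card_cartesian_product)
  qed
  moreover have "bt u \<inter> bt v = {}" if "u \<in> P" "v \<in> P" "u \<noteq> v" for u v
  proof -
    have "bt u \<inter> bt v = g ` (({u} \<times> {..<N}) \<inter> ({v} \<times> {..<N}))"
      unfolding bt_def using that by (intro inj_on_image_Int[OF inj, symmetric]) auto
    then show ?thesis using that by auto
  qed
  ultimately show ?thesis using that P z by blast
qed

text \<open>\<open>failure_mass\<close> is relative to the family without edge parity; conditioning
  on that parity costs the factor \<open>2 * \<rho>\<close>.\<close>

lemma prob_failure_le:
  fixes V :: "nat set" and p :: real
  defines "\<rho> \<equiv> max (p / (1 - p)) ((1 - p) / p)"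
  assumes p: "0 < p" "p < 1" and V: "finite V" and A: "A \<subseteq> V"
    and feasible: "set_pmf (gnp V p) \<inter> revealed_event A H d b \<noteq> {}"
    and N: "1 \<le> N" "1 + N + N * N + card A \<le> card V"
  shows "measure_pmf.prob (cond_pmf (gnp V p) (revealed_event A H d b)) {E. \<not> even_degenerate V E} \<le>
    2 * \<rho> * (real N * flip_weight.miss \<rho> ^ N +
      (real (card V) + flip_weight.offset \<rho>) / flip_weight.decay \<rho> *
      (1 - (1 - flip_weight.decay \<rho>) / (2 * \<rho>)) ^ N)"
proof -
  let ?G = "gnp V p"
  interpret flip_weight V "pmf ?G" \<rho>
    unfolding \<rho>_def using gnp_flip_weight[OF V p] .
  have finA: "finite A" using A V finite_subset by blast
  have "card (V - A) = card V - card A" using A finA by (simp add: card_Diff_subset)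
  then have "1 + N + N * N \<le> card (V - A)" using N by linarith
  then obtain z P bt where P: "P \<subseteq> V - A" "card P = N" "z \<in> V - A - P"
    and bt: "\<And>v. v \<in> P \<Longrightarrow> bt v \<subseteq> V - A - P - {z} \<and> card (bt v) = N"
    and disj: "\<And>u v. u \<in> P \<Longrightarrow> v \<in> P \<Longrightarrow> u \<noteq> v \<Longrightarrow> bt u \<inter> bt v = {}"
    using batches_exist[of "V - A" N] V by (metis finite_Diff)
  let ?X = "exposed_graphs V A H d"
  let ?S = "revealed_event A H d b"
  let ?rate = "real N * miss ^ N + (real (card V) + offset) / decay * (1 - (1 - decay) / (2 * \<rho>)) ^ N"
  have X: "?X \<subseteq> Pow (vertex_pairs V)" by (auto simp: exposed_graphs_def)
  have prob: "measure_pmf.prob ?G T = sum (pmf ?G) {E \<in> Pow (vertex_pairs V). E \<in> T}" for T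
  proof -
    have "measure_pmf.prob ?G T = measure_pmf.prob ?G {E \<in> Pow (vertex_pairs V). E \<in> T}"
      using set_gnp_subset[OF V, of p] by (intro measure_eq_AE) (auto simp: AE_measure_pmf_iff)
    also have "\<dots> = sum (pmf ?G) {E \<in> Pow (vertex_pairs V). E \<in> T}"
      using finite_vertex_pairs[OF V] by (intro measure_measure_pmf_finite) auto
    finally show ?thesis .
  qed
  have S: "measure_pmf.prob ?G ?S = sum (pmf ?G) {E \<in> ?X. even (card E) = b}"
    unfolding prob by (rule arg_cong[of _ _ "sum _"]) (auto simp: revealed_event_def exposed_graphs_def)
  have bad: "measure_pmf.prob ?G (?S \<inter> {E. \<not> even_degenerate V E}) =
      sum (pmf ?G) {E \<in> ?X. even (card E) = b \<and> \<not> even_degenerate V E}"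
    unfolding prob by (rule arg_cong[of _ _ "sum _"]) (auto simp: revealed_event_def exposed_graphs_def)
  have rate: "0 \<le> ?rate"
  proof -
    have "0 \<le> 1 - (1 - decay) / (2 * \<rho>)" using decay_bounds rho by (simp add: divide_le_eq)
    then show ?thesis using miss_bounds decay_bounds offset_ge by simp
  qed
  have pos: "0 < measure_pmf.prob ?G ?S"
    using feasible by (auto simp: measure_pmf_posI)
  have "P \<noteq> {}" using P N by auto
  have "measure_pmf.prob ?G (?S \<inter> {E. \<not> even_degenerate V E}) \<le> ?rate * sum (pmf ?G) ?X"
    unfolding bad using failure_mass[OF A P(1,3) bt disj, where H = H and d = d and b = b] P(2) by simp
  also have "\<dots> \<le> ?rate * (2 * \<rho> * measure_pmf.prob ?G ?S)"
    unfolding S using exposed_parity_mass[OF A P(1,3) bt disj \<open>P \<noteq> {}\<close>, where H = H and d = d and b = b] rate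
    by (intro mult_left_mono) auto
  also have "\<dots> = 2 * \<rho> * ?rate * measure_pmf.prob ?G ?S" by (simp only: mult_ac)
  finally show ?thesis
    unfolding prob_cond_pmf[OF feasible] pos_divide_le_eq[OF pos] .
qed

theorem theorem6p3:
  fixes \<alpha> p :: real
  assumes "0 < \<alpha>" and "\<alpha> < 1/2" and "0 < p" and "p < 1"
  shows "\<exists>K\<^sub>0 > 0. \<exists>M :: nat. \<forall>n \<ge> M.
           f_max \<alpha> p n \<le> exp (- K\<^sub>0 * real n powr (1/2 - \<alpha>))"
proof -
  define \<rho> where "\<rho> = max (p / (1 - p)) ((1 - p) / p)"
  \<comment> \<open>The constants depend on \<open>\<rho>\<close> alone, so the empty vertex set
    suffices to make their bounds available.\<close>
  interpret flip_weight "{} :: nat set" "pmf (gnp {} p)" \<rho>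
    unfolding \<rho>_def using assms by (intro gnp_flip_weight) auto
  define \<beta> where "\<beta> = 1/2 - \<alpha>"
  have \<beta>: "0 < \<beta>" "\<beta> < 1/2" using assms by (auto simp: \<beta>_def)
  define \<kappa> where "\<kappa> = 1 - (1 - decay) / (2 * \<rho>)"
  have \<kappa>: "0 \<le> \<kappa>" "\<kappa> < 1" using decay_bounds rho by (auto simp: \<kappa>_def divide_le_eq)
  define m where "m = max (1/2) (max miss \<kappa>)"
  have m: "0 < m" "m < 1" "miss \<le> m" "\<kappa> \<le> m" using \<kappa> miss_bounds by (auto simp: m_def)
  define L where "L = - ln m"
  have L: "0 < L" using m by (simp add: L_def)
  \<comment> \<open>Reservoir and batches take about \<open>n powr (2 * \<beta>)\<close> vertices,
    the same order as the bound on \<open>card A\<close>; since \<open>2 * \<beta> < 1\<close>,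
    there is room for all of them.\<close>
  define N where "N n = nat \<lceil>real n powr \<beta>\<rceil>" for n
  define C where "C = offset"
  have C: "1 \<le> C" using offset_ge by (simp add: C_def)
  \<comment> \<open>Half of the exponent absorbs the polynomial factor, the other half is the final
    bound.\<close>
  have "((\<lambda>n. 2 * \<rho> * (real n powr \<beta> + 1 + (real n + C) / decay) * exp (- (L / 2) * real n powr \<beta>))
      \<longlongrightarrow> 0) sequentially"
    using \<beta> L C decay_bounds rho by real_asymp
  then have ev1: "\<forall>\<^sub>F n in sequentially.
      2 * \<rho> * (real n powr \<beta> + 1 + (real n + C) / decay) * exp (- (L / 2) * real n powr \<beta>) < 1"
    by (rule order_tendstoD) simp
  have ev2: "\<forall>\<^sub>F n in sequentially.
      1 + (real n powr \<beta> + 1) + (real n powr \<beta> + 1) * (real n powr \<beta> + 1) + real n powr (2 * \<beta>) \<le> real n"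
    using \<beta> by real_asymp
  have "\<forall>\<^sub>F n in sequentially. f_max \<alpha> p n \<le> exp (- (L / 2) * real n powr \<beta>)"
    using ev1 ev2 eventually_gt_at_top[of 0]
  proof eventually_elim
    case (elim n)
    have N: "real n powr \<beta> \<le> real (N n)" "real (N n) \<le> real n powr \<beta> + 1"
      unfolding N_def by (simp_all add: real_nat_ceiling_ge)
    have "0 < real n powr \<beta>" using elim by simp
    then have N1: "1 \<le> N n" using N by linarith
    have "real (N n) * real (N n) \<le> (real n powr \<beta> + 1) * (real n powr \<beta> + 1)"
      using N by (intro mult_mono) auto
    then have size: "1 + real (N n) + real (N n) * real (N n) + real n powr (2 * \<beta>) \<le> real n"
      using elim(2) N by linarith
    have mN: "m ^ N n \<le> exp (- L * real n powr \<beta>)"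
    proof -
      have "m ^ N n = exp (- L * real (N n))"
        using m exp_of_nat_mult[of "N n" "ln m"] by (simp add: L_def mult.commute)
      also have "\<dots> \<le> exp (- L * real n powr \<beta>)" using N L by simp
      finally show ?thesis .
    qed
    let ?E = "exp (- L * real n powr \<beta>)"
    have "r \<le> exp (- (L / 2) * real n powr \<beta>)" if "r \<in> failure_probs \<alpha> p n" for r
    proof -
      from that obtain V :: "nat set" and G where V: "card V = n"
        and G: "partially_revealed \<alpha> p V G"
        and r: "r = measure_pmf.prob G {E. \<not> even_degenerate V E}"
        unfolding failure_probs_def by blast
      from G obtain A H d b where finV: "finite V" and A: "A \<subseteq> V"
        and cA: "real (card A) \<le> real (card V) powr (1 - 2 * \<alpha>)"
        and feas: "set_pmf (gnp V p) \<inter> revealed_event A H d b \<noteq> {}"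
        and G_eq: "G = cond_pmf (gnp V p) (revealed_event A H d b)"
        unfolding partially_revealed_def by blast
      have "1 - 2 * \<alpha> = 2 * \<beta>" by (simp add: \<beta>_def)
      then have "real (1 + N n + N n * N n + card A) \<le> real n" using cA size V by simp
      then have "1 + N n + N n * N n + card A \<le> card V" using V by (simp only: of_nat_le_iff)
      from prob_failure_le[OF assms(3,4) finV A feas N1 this]
      have "r \<le> 2 * \<rho> * (real (N n) * miss ^ N n + (real n + C) / decay * \<kappa> ^ N n)"
        unfolding r G_eq \<rho>_def[symmetric] C_def \<kappa>_def V .
      also have "\<dots> \<le> 2 * \<rho> * ((real n powr \<beta> + 1) * ?E + (real n + C) / decay * ?E)"
      proof (intro mult_left_mono add_mono mult_mono)
        show "miss ^ N n \<le> ?E" using power_mono[OF m(3) miss_bounds(1), of "N n"] mN by linarith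
        show "\<kappa> ^ N n \<le> ?E" using power_mono[OF m(4) \<kappa>(1), of "N n"] mN by linarith
      qed (use N C \<kappa> miss_bounds decay_bounds rho in auto)
      also have "?E = exp (- (L / 2) * real n powr \<beta>) * exp (- (L / 2) * real n powr \<beta>)"
        by (simp add: exp_add[symmetric])
      also have "2 * \<rho> * ((real n powr \<beta> + 1) * \<dots> + (real n + C) / decay * \<dots>) =
          2 * \<rho> * (real n powr \<beta> + 1 + (real n + C) / decay) * exp (- (L / 2) * real n powr \<beta>) *
            exp (- (L / 2) * real n powr \<beta>)"
        by (simp only: distrib_right distrib_left mult.assoc)
      also have "\<dots> \<le> 1 * exp (- (L / 2) * real n powr \<beta>)"
        using elim(1) by (intro mult_right_mono) auto
      finally show ?thesis by simp
    qed
    then show ?case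
      unfolding f_max_def
      using finite_failure_probs[OF assms(3,4)] failure_probs_nonempty[OF assms(3,4)]
      by (subst Max_le_iff) auto
  qed
  then obtain M where "\<And>n. n \<ge> M \<Longrightarrow> f_max \<alpha> p n \<le> exp (- (L / 2) * real n powr \<beta>)"
    unfolding eventually_sequentially by blast
  then show ?thesis
    using L by (intro exI[of _ "L / 2"] conjI exI[of _ M]) (auto simp: \<beta>_def)
qed

end
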